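(* For all integers $m,n,t\ge 1$, $$\frac{F_D(\bar q)}{F_T(\bar q)}=\sum_{\pi_1\cdots\pi_t=1}\ \prod_{i=1}^t q_i^{\text{flag-major}(\pi_i)},$$ as formal power series in $\bar q=(q_1,\dots,q_t)$, where the sum extends over all $t$-tuples $(\pi_1,\dots,\pi_t)$ of elements of $G=C_m\wr S_n$ such that the product $\pi_1\pi_2\cdots\pi_t$ is equal to the identity element. Here $F_D$ and $F_T$ are the Hilbert series of the diagonal invariant algebra and of the tensor invariant algebra of $G$, respectively.
   Context: Let $\omega=\exp(2\pi i/m)\in\mathbb{C}$ and $\mathbb{N}=\{0,1,2,\dots\}$. Elements of $G=C_m\wr S_n$ ($C_m$ cyclic of order $m$) are generalized permutations $\pi=(\pi(1),\dots,\pi(n))$: each $\pi(i)\in\mathbb{C}$, each $\pi(i)/|\pi(i)|$ is a power of $\omega$, and $(|\pi(1)|,\dots,|\pi(n)|)$ is a permutation of $\{1,\dots,n\}$. Extending by $\pi(\omega^a j)=\omega^a\pi(j)$, the product is composition $(\pi\sigma)(j)=\pi(\sigma(j))$. The group is generated by $s_0,\dots,s_{n-1}$, where $s_0(1)=\omega$, $s_0(j)=j$ for $2\le j\le n$, and, for $1\le i<n$, $s_i$ exchanges $i$ and $i+1$ and fixes all other $j\in\{1,\dots,n\}$. Flag major index: put $t_i:=s_i s_{i-1}\cdots s_1 s_0$ for $0\le i\le n-1$. Every $\pi\in G$ has a unique representation $\pi=t_{n-1}^{k_{n-1}}\cdots t_1^{k_1}t_0^{k_0}$ with integers $0\le k_i<m(i+1)$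 for all $i$, and $\text{flag-major}(\pi):=\sum_{i=0}^{n-1}k_i$. Actions: let $P_n=\mathbb{C}[x_1,\dots,x_n]$. $G$ acts on $P_n$ by algebra automorphisms $\varphi(\pi)$ determined by $\varphi(\pi)(x_j)=\frac{\pi(j)}{|\pi(j)|}\,x_{|\pi(j)|}$ for $1\le j\le n$. Let $P_n^{\otimes t}$ be the $t$-fold tensor power over $\mathbb{C}$, with the natural tensor action $\varphi_T$ of $G^t=G\times\cdots\times G$ (the $i$-th factor acting on the $i$-th tensor factor via $\varphi$), and the diagonal action $\varphi_D(g):=\varphi_T(g,\dots,g)$ of $G$. The tensor invariant algebra is $\mathrm{TIA}:=\{p\in P_n^{\otimes t}: \varphi_T(\bar g)(p)=p\ \ \forall \bar g\in G^t\}$, and the diagonal invariant algebra is $\mathrm{DIA}:=\{p\in P_n^{\otimes t}:\varphi_D(g)(p)=p\ \ \forall g\in G\}$. Hilbert series: $P_n^{\otimes t}$ is $\mathbb{N}^t$-graded by multi-degree (the $i$-th component is the degree in the $i$-th tensor factor). Let $\mathrm{DIA}_{n_1,\dots,n_t}$ be the homogeneous piece of multi-degree $(n_1,\dots,n_t)$ in $\mathrm{DIA}$, and set $F_D(\bar q):=\sum_{n_1,\dots,n_t\in\mathbb{N}}(\dim_{\mathbb{C}}\mathrm{DIA}_{n_1,\dots,n_t})\,q_1^{n_1}\cdots q_t^{n_t}$. Define $F_T(\bar q)$ similarly for $\mathrm{TIA}$. *)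

theory Defs
  imports
    "HOL-Library.Poly_Mapping"
    "HOL-Library.FuncSet"
    "HOL-Algebra.Group"
    Complex_Main
begin

abbreviation "lookup \<equiv> Poly_Mapping.lookup"
abbreviation "keys \<equiv> Poly_Mapping.keys"


section \<open>Formal power series in several variables\<close>

text \<open>
  A monomial \<open>q\<^sub>0\<^bsup>k(0)\<^esup> q\<^sub>1\<^bsup>k(1)\<^esup> \<dots>\<close> is represented by its finitely supported exponent
  function \<open>k\<close>. Power series in \<open>t\<close> variables are those that involve only the variables
  with index below \<open>t\<close>.
\<close>

typedef 'a mfps = "UNIV :: ((nat \<Rightarrow>\<^sub>0 nat) \<Rightarrow> 'a) set"
  morphisms mfps_nth Abs_mfps ..

lemma mfps_nth_Abs [simp]: "mfps_nth (Abs_mfps f) k = f k"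
  by (simp add: Abs_mfps_inverse)

lemma mfps_ext: "(\<And>k. mfps_nth f k = mfps_nth g k) \<Longrightarrow> f = g"
  by (simp add: fun_eq_iff flip: mfps_nth_inject)

definition splits :: "(nat \<Rightarrow>\<^sub>0 nat) \<Rightarrow> ((nat \<Rightarrow>\<^sub>0 nat) \<times> (nat \<Rightarrow>\<^sub>0 nat)) set"
  where "splits k = {(a, b). a + b = k}"

lemma finite_splits [simp]: "finite (splits k)"
proof -
  define S where "S = {f :: nat \<Rightarrow> nat.
    \<forall>i. (i \<in> keys k \<longrightarrow> f i \<in> {..Max (lookup k ` keys k)}) \<and> (i \<notin> keys k \<longrightarrow> f i = 0)}"
  have fin: "finite S"
    unfolding S_def by (rule finite_set_of_finite_funs) auto
  have mem: "lookup a \<in> S" if le: "\<And>i. lookup a i \<le> lookup k i" for a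
  proof -
    have "lookup a i \<le> Max (lookup k ` keys k)" if "i \<in> keys k" for i
      by (rule order.trans[OF le Max_ge]) (use that in simp_all)
    moreover have "lookup a i = 0" if "i \<notin> keys k" for i
      using that le[of i] by (simp add: in_keys_iff)
    ultimately show ?thesis
      unfolding S_def by simp
  qed
  have "inj (lookup :: (nat \<Rightarrow>\<^sub>0 nat) \<Rightarrow> _)"
    by (simp add: inj_def)
  with fin have "finite (lookup -` S)"
    by (rule finite_vimageI)
  hence fin2: "finite ((lookup -` S) \<times> (lookup -` S))"
    by (rule finite_cartesian_product) (fact \<open>finite (lookup -` S)\<close>)
  have "p \<in> (lookup -` S) \<times> (lookup -` S)" if "p \<in> splits k" for p
  proof -
    have k: "k = fst p + snd p"
      using that by (simp add: splits_def case_prod_unfold)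
    have "lookup (fst p) \<in> S" "lookup (snd p) \<in> S"
      by (rule mem, simp add: k lookup_add)+
    thus ?thesis
      by (simp add: mem_Times_iff)
  qed
  thus ?thesis
    by (intro finite_subset[OF _ fin2] subsetI)
qed

instantiation mfps :: (comm_ring_1) comm_ring_1
begin

definition "0 = Abs_mfps (\<lambda>_. 0)"
definition "1 = Abs_mfps (\<lambda>k. if k = 0 then 1 else 0)"
definition "f + g = Abs_mfps (\<lambda>k. mfps_nth f k + mfps_nth g k)"
definition "f - g = Abs_mfps (\<lambda>k. mfps_nth f k - mfps_nth g k)"
definition "- f = Abs_mfps (\<lambda>k. - mfps_nth f k)"
definition "f * g = Abs_mfps (\<lambda>k. \<Sum>(a, b) \<in> splits k. mfps_nth f a * mfps_nth g b)"

instance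
proof
  fix f g h :: "'a mfps"
  show "f * g * h = f * (g * h)"
  proof (rule mfps_ext)
    fix k
    have "mfps_nth (f * g * h) k
        = (\<Sum>p\<in>splits k. \<Sum>q\<in>splits (fst p). mfps_nth f (fst q) * mfps_nth g (snd q) * mfps_nth h (snd p))"
      by (simp add: times_mfps_def case_prod_unfold sum_distrib_right)
    also have "\<dots> = (\<Sum>(p, q)\<in>Sigma (splits k) (\<lambda>p. splits (fst p)).
        mfps_nth f (fst q) * mfps_nth g (snd q) * mfps_nth h (snd p))"
      by (subst sum.Sigma) auto
    also have "\<dots> = (\<Sum>(p, q)\<in>Sigma (splits k) (\<lambda>p. splits (snd p)).
        mfps_nth f (fst p) * (mfps_nth g (fst q) * mfps_nth h (snd q)))"
      by (rule sum.reindex_bij_witness[where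
            i = "\<lambda>(p, q). ((fst p + fst q, snd q), (fst p, fst q))" and
            j = "\<lambda>(p, q). ((fst q, snd q + snd p), (snd q, snd p))"])
         (auto simp: splits_def algebra_simps)
    also have "\<dots> = (\<Sum>p\<in>splits k. \<Sum>q\<in>splits (snd p). mfps_nth f (fst p) * (mfps_nth g (fst q) * mfps_nth h (snd q)))"
      by (subst sum.Sigma) auto
    also have "\<dots> = mfps_nth (f * (g * h)) k"
      by (simp add: times_mfps_def case_prod_unfold sum_distrib_left)
    finally show "mfps_nth (f * g * h) k = mfps_nth (f * (g * h)) k" .
  qed
  show "f * g = g * f"
    unfolding times_mfps_def
    by (rule arg_cong[where f = Abs_mfps], rule ext,
        rule sum.reindex_bij_witness[where i = prod.swap and j = prod.swap])
       (auto simp: splits_def algebra_simps)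
  show "1 * f = f"
  proof (rule mfps_ext)
    fix k
    have mem: "(0, k) \<in> splits k"
      by (simp add: splits_def)
    have "mfps_nth (1 * f) k = (\<Sum>(a, b)\<in>splits k. if (a, b) = (0, k) then mfps_nth f k else 0)"
      unfolding times_mfps_def one_mfps_def mfps_nth_Abs
      by (rule sum.cong) (auto simp: splits_def)
    also have "\<dots> = (\<Sum>p\<in>splits k. if p = (0, k) then mfps_nth f k else 0)"
      by (rule sum.cong) (auto split: prod.splits)
    also have "\<dots> = mfps_nth f k"
      using mem by simp
    finally show "mfps_nth (1 * f) k = mfps_nth f k" .
  qed
  show "(f + g) * h = f * h + g * h"
    by (rule mfps_ext)
       (simp add: times_mfps_def plus_mfps_def case_prod_unfold algebra_simps sum.distrib)
  show "(0 :: 'a mfps) \<noteq> 1"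
  proof
    assume "(0 :: 'a mfps) = 1"
    hence "mfps_nth (0 :: 'a mfps) 0 = mfps_nth 1 0" by simp
    thus False by (simp add: zero_mfps_def one_mfps_def)
  qed
  show "f + g + h = f + (g + h)"
    by (rule mfps_ext) (simp add: plus_mfps_def add.assoc)
  show "f + g = g + f"
    by (rule mfps_ext) (simp add: plus_mfps_def add.commute)
  show "0 + f = f"
    by (rule mfps_ext) (simp add: plus_mfps_def zero_mfps_def)
  show "- f + f = 0"
    by (rule mfps_ext) (simp add: plus_mfps_def zero_mfps_def uminus_mfps_def)
  show "f - g = f + - g"
    by (rule mfps_ext) (simp add: plus_mfps_def minus_mfps_def uminus_mfps_def)
qed

end

definition mono_deg :: "(nat \<Rightarrow>\<^sub>0 nat) \<Rightarrow> nat"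
  where "mono_deg k = (\<Sum>i\<in>keys k. lookup k i)"

lemma mono_deg_less:
  assumes "a + b = k" "a \<noteq> 0"
  shows "mono_deg b < mono_deg k"
proof -
  have fin: "finite (keys k)" and sub: "keys b \<subseteq> keys k"
    using assms(1) by (auto simp: in_keys_iff lookup_add)
  obtain i where i: "lookup a i \<noteq> 0"
    using assms(2) by (metis poly_mapping_eqI lookup_zero)
  have "mono_deg b = (\<Sum>i\<in>keys k. lookup b i)"
    unfolding mono_deg_def
    by (rule sum.mono_neutral_left) (use fin sub in \<open>auto simp: in_keys_iff\<close>)
  also have "\<dots> < (\<Sum>i\<in>keys k. lookup k i)"
    by (rule sum_strict_mono_ex1)
       (use assms(1) i in \<open>auto simp: lookup_add in_keys_iff intro!: bexI[of _ i]\<close>)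
  finally show ?thesis
    unfolding mono_deg_def .
qed

function mfps_inv_coeff :: "'a :: field mfps \<Rightarrow> (nat \<Rightarrow>\<^sub>0 nat) \<Rightarrow> 'a" where
  "mfps_inv_coeff f k =
    (if k = 0 then inverse (mfps_nth f 0)
     else - inverse (mfps_nth f 0) *
       (\<Sum>(a, b) \<in> {(a, b). a + b = k \<and> a \<noteq> 0}. mfps_nth f a * mfps_inv_coeff f b))"
  by pat_completeness auto
termination
  by (relation "measure (\<lambda>(f, k). mono_deg k)") (auto simp: mono_deg_less)

declare mfps_inv_coeff.simps [simp del]

text \<open>
  As for univariate power series in the library, the inverse is meaningful
  only if the constant coefficient is nonzero.
\<close>

instantiation mfps :: (field) inverse
begin

definition "inverse f = Abs_mfps (mfps_inv_coeff f)"
definition "divide f (g :: 'a mfps) = f * inverse g"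

instance ..

end

lemma mfps_mult_inverse:
  fixes f :: "'a :: field mfps"
  assumes "mfps_nth f 0 \<noteq> 0"
  shows "f * inverse f = 1"
proof (rule mfps_ext)
  fix k
  let ?g = "mfps_inv_coeff f"
  have split: "splits k = insert (0, k) {(a, b). a + b = k \<and> a \<noteq> 0}"
    by (auto simp: splits_def)
  have fin: "finite {(a, b). a + b = k \<and> a \<noteq> 0}"
    by (rule finite_subset[OF _ finite_splits[of k]]) (auto simp: splits_def)
  have "mfps_nth (f * inverse f) k = mfps_nth f 0 * ?g k +
      (\<Sum>(a, b) \<in> {(a, b). a + b = k \<and> a \<noteq> 0}. mfps_nth f a * ?g b)"
    unfolding times_mfps_def inverse_mfps_def mfps_nth_Abs split
    using fin by (subst sum.insert) auto
  also have "\<dots> = mfps_nth 1 k"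
  proof (cases "k = 0")
    case True
    have empty: "{(a, b). a + b = k \<and> a \<noteq> 0} = {}"
      using mono_deg_less[of _ _ k] True by (auto simp: mono_deg_def)
    show ?thesis
      unfolding empty using True assms by (simp add: one_mfps_def mfps_inv_coeff.simps[of f 0])
  next
    case False
    show ?thesis
      using False assms
      by (subst mfps_inv_coeff.simps) (simp add: one_mfps_def)
  qed
  finally show "mfps_nth (f * inverse f) k = mfps_nth 1 k" .
qed

lemma mfps_divide_eq_iff:
  fixes f g h :: "'a :: field mfps"
  assumes "mfps_nth g 0 \<noteq> 0"
  shows "f / g = h \<longleftrightarrow> f = h * g"
proof
  assume "f / g = h"
  hence "h * g = f * (g * inverse g)"
    by (auto simp: divide_mfps_def mult_ac)
  thus "f = h * g"
    by (simp add: mfps_mult_inverse[OF assms])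
next
  assume "f = h * g"
  hence "f / g = h * (g * inverse g)"
    by (simp add: divide_mfps_def mult_ac)
  thus "f / g = h"
    by (simp add: mfps_mult_inverse[OF assms])
qed

definition mfps_var :: "nat \<Rightarrow> 'a :: comm_ring_1 mfps"
  where "mfps_var i = Abs_mfps (\<lambda>k. if k = Poly_Mapping.single i 1 then 1 else 0)"


section \<open>The wreath product of a cyclic group with a symmetric group\<close>

definition omega :: "nat \<Rightarrow> complex"
  where "omega m = exp (2 * of_real pi * \<i> / of_nat m)"

definition phase :: "complex \<Rightarrow> complex"
  where "phase z = z / of_real (cmod z)"

text \<open>The modulus as a natural number; only used where the modulus is integral.\<close>

definition nmod :: "complex \<Rightarrow> nat"
  where "nmod z = nat \<lfloor>cmod z\<rfloor>"

definition gperms :: "nat \<Rightarrow> nat \<Rightarrow> (nat \<Rightarrow> complex) set"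
  where "gperms m n = {\<pi> \<in> extensional {1..n}.
    (\<forall>i\<in>{1..n}. \<exists>a::nat. phase (\<pi> i) = omega m ^ a) \<and>
    bij_betw (\<lambda>i. cmod (\<pi> i)) {1..n} (real ` {1..n})}"

text \<open>The extension of \<open>\<pi>\<close> to all \<open>\<omega>\<^sup>a j\<close>, determined by \<open>\<pi>(\<omega>\<^sup>a j) = \<omega>\<^sup>a \<pi>(j)\<close>.\<close>

definition gapply :: "(nat \<Rightarrow> complex) \<Rightarrow> complex \<Rightarrow> complex"
  where "gapply \<pi> z = phase z * \<pi> (nmod z)"

definition wreath :: "nat \<Rightarrow> nat \<Rightarrow> (nat \<Rightarrow> complex) monoid"
  where "wreath m n = \<lparr>
    carrier = gperms m n,
    mult = (\<lambda>\<pi> \<sigma>. \<lambda>j\<in>{1..n}. gapply \<pi> (\<sigma> j)),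
    one = (\<lambda>j\<in>{1..n}. of_nat j)\<rparr>"

lemma phase_mult: "phase (z * w) = phase z * phase w"
  by (simp add: phase_def norm_mult)

lemma phase_of_nat: "n > 0 \<Longrightarrow> phase (of_nat n) = 1"
  by (simp add: phase_def)

lemma phase_mult_nmod: "cmod z = real k \<Longrightarrow> phase z * of_nat k = z"
  by (cases "k = 0") (auto simp: phase_def)

lemma nmod_eq: "cmod z = real k \<Longrightarrow> nmod z = k"
  by (simp add: nmod_def)

lemma omega_power_m: "m > 0 \<Longrightarrow> omega m ^ m = 1"
  by (simp add: omega_def flip: exp_of_nat_mult)

lemma norm_omega: "cmod (omega m) = 1"
proof -
  have "2 * of_real pi * \<i> / of_nat m = \<i> * of_real (2 * pi / real m)"
    by simp
  hence "omega m = cis (2 * pi / real m)"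
    unfolding omega_def by (simp only: cis_conv_exp)
  thus ?thesis
    by simp
qed

lemma phase_omega_power: "phase (omega m ^ a) = omega m ^ a"
  by (simp add: phase_def norm_power norm_omega)

lemma gpermsD:
  assumes "\<pi> \<in> gperms m n" "i \<in> {1..n}"
  shows "nmod (\<pi> i) \<in> {1..n}" "cmod (\<pi> i) = real (nmod (\<pi> i))"
    "\<exists>a::nat. phase (\<pi> i) = omega m ^ a"
proof -
  have "cmod (\<pi> i) \<in> real ` {1..n}"
    using assms unfolding gperms_def by (auto dest: bij_betwE)
  then obtain k where "k \<in> {1..n}" "cmod (\<pi> i) = real k"
    by blast
  thus "nmod (\<pi> i) \<in> {1..n}" "cmod (\<pi> i) = real (nmod (\<pi> i))"
    using nmod_eq by auto
  show "\<exists>a::nat. phase (\<pi> i) = omega m ^ a"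
    using assms unfolding gperms_def by auto
qed

lemma bij_betw_nmod:
  assumes "\<pi> \<in> gperms m n"
  shows "bij_betw (\<lambda>i. nmod (\<pi> i)) {1..n} {1..n}"
proof -
  have inj: "inj_on (\<lambda>i. cmod (\<pi> i)) {1..n}"
    using assms by (auto simp: gperms_def bij_betw_def)
  have "inj_on (\<lambda>i. nmod (\<pi> i)) {1..n}"
    using gpermsD(2)[OF assms] by (intro inj_onI inj_onD[OF inj]) auto
  moreover have "(\<lambda>i. nmod (\<pi> i)) ` {1..n} \<subseteq> {1..n}"
    using gpermsD(1)[OF assms] by auto
  ultimately show ?thesis
    by (simp add: bij_betw_def endo_inj_surj)
qed

lemma gpermsI:
  assumes "\<pi> \<in> extensional {1..n}"
    and "\<And>i. i \<in> {1..n} \<Longrightarrow> \<exists>a::nat. phase (\<pi> i) = omega m ^ a"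
    and "\<And>i. i \<in> {1..n} \<Longrightarrow> cmod (\<pi> i) = real (f i)"
    and "bij_betw f {1..n} {1..n}"
  shows "\<pi> \<in> gperms m n"
proof -
  have "bij_betw real {1..n} (real ` {1..n})"
    by (simp add: bij_betw_def)
  with assms(4) have "bij_betw (real \<circ> f) {1..n} (real ` {1..n})"
    by (rule bij_betw_trans)
  hence "bij_betw (\<lambda>i. cmod (\<pi> i)) {1..n} (real ` {1..n})"
    by (subst bij_betw_cong[where g = "real \<circ> f"]) (auto simp: assms(3))
  thus ?thesis
    using assms(1,2) by (simp add: gperms_def)
qed

lemma gapply_mult:
  assumes "\<sigma> \<in> gperms m n" "nmod z \<in> {1..n}"
  shows "gapply \<pi> (gapply \<sigma> z) = gapply (\<lambda>j\<in>{1..n}. gapply \<pi> (\<sigma> j)) z"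
proof -
  have z: "cmod (phase z) = 1"
    using assms(2) by (auto simp: phase_def nmod_def norm_divide)
  have "phase (phase z) = phase z"
    unfolding phase_def[of "phase z"] z by simp
  moreover have "nmod (phase z * \<sigma> (nmod z)) = nmod (\<sigma> (nmod z))"
    by (simp add: nmod_def norm_mult z)
  ultimately show ?thesis
    using assms(2) by (simp add: gapply_def phase_mult)
qed

lemma group_wreath:
  assumes "m \<ge> 1"
  shows "group (wreath m n)"
proof (rule groupI)
  fix \<pi> \<sigma> assume "\<pi> \<in> carrier (wreath m n)" "\<sigma> \<in> carrier (wreath m n)"
  hence \<pi>: "\<pi> \<in> gperms m n" and \<sigma>: "\<sigma> \<in> gperms m n"
    by (auto simp: wreath_def)
  have "(\<lambda>j\<in>{1..n}. gapply \<pi> (\<sigma> j)) \<in> gperms m n"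
  proof (rule gpermsI)
    fix i assume i: "i \<in> {1..n}"
    obtain a where a: "phase (\<sigma> i) = omega m ^ a"
      using gpermsD(3)[OF \<sigma> i] by blast
    obtain b where b: "phase (\<pi> (nmod (\<sigma> i))) = omega m ^ b"
      using gpermsD(3)[OF \<pi> gpermsD(1)[OF \<sigma> i]] by blast
    have "phase (gapply \<pi> (\<sigma> i)) = omega m ^ (a + b)"
      by (simp add: gapply_def phase_mult a b phase_omega_power power_add)
    thus "\<exists>a. phase ((\<lambda>j\<in>{1..n}. gapply \<pi> (\<sigma> j)) i) = omega m ^ a"
      using i by auto
    show "cmod ((\<lambda>j\<in>{1..n}. gapply \<pi> (\<sigma> j)) i)
        = real (((\<lambda>i. nmod (\<pi> i)) \<circ> (\<lambda>i. nmod (\<sigma> i))) i)"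
      using i gpermsD(2)[OF \<pi> gpermsD(1)[OF \<sigma> i]]
      by (simp add: gapply_def norm_mult a norm_power norm_omega)
  next
    show "bij_betw ((\<lambda>i. nmod (\<pi> i)) \<circ> (\<lambda>i. nmod (\<sigma> i))) {1..n} {1..n}"
      by (rule bij_betw_trans[OF bij_betw_nmod[OF \<sigma>] bij_betw_nmod[OF \<pi>]])
  qed auto
  thus "\<pi> \<otimes>\<^bsub>wreath m n\<^esub> \<sigma> \<in> carrier (wreath m n)"
    by (simp add: wreath_def)
next
  have "(\<lambda>j\<in>{1..n}. of_nat j) \<in> gperms m n"
    by (rule gpermsI[where f = "\<lambda>i. i"])
       (auto simp: phase_of_nat bij_betw_def intro!: exI[of _ 0])
  thus "\<one>\<^bsub>wreath m n\<^esub> \<in> carrier (wreath m n)"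
    by (simp add: wreath_def)
next
  fix \<pi> \<sigma> \<tau>
  assume "\<pi> \<in> carrier (wreath m n)" "\<sigma> \<in> carrier (wreath m n)" "\<tau> \<in> carrier (wreath m n)"
  thus "\<pi> \<otimes>\<^bsub>wreath m n\<^esub> \<sigma> \<otimes>\<^bsub>wreath m n\<^esub> \<tau> = \<pi> \<otimes>\<^bsub>wreath m n\<^esub> (\<sigma> \<otimes>\<^bsub>wreath m n\<^esub> \<tau>)"
    using gpermsD(1) by (auto simp: wreath_def gapply_mult intro!: restrict_ext)
next
  fix \<pi> assume "\<pi> \<in> carrier (wreath m n)"
  hence \<pi>: "\<pi> \<in> gperms m n"
    by (simp add: wreath_def)
  show "\<one>\<^bsub>wreath m n\<^esub> \<otimes>\<^bsub>wreath m n\<^esub> \<pi> = \<pi>"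
  proof
    fix i
    show "(\<one>\<^bsub>wreath m n\<^esub> \<otimes>\<^bsub>wreath m n\<^esub> \<pi>) i = \<pi> i"
    proof (cases "i \<in> {1..n}")
      case True
      thus ?thesis
        using gpermsD(1,2)[OF \<pi> True] phase_mult_nmod by (simp add: wreath_def gapply_def)
    next
      case False
      thus ?thesis
        using \<pi> by (auto simp: wreath_def gperms_def extensional_def)
    qed
  qed
  define f where "f = inv_into {1..n} (\<lambda>i. nmod (\<pi> i))"
  have bij: "bij_betw f {1..n} {1..n}"
    unfolding f_def by (rule bij_betw_inv_into[OF bij_betw_nmod[OF \<pi>]])
  have f: "f j \<in> {1..n}" "nmod (\<pi> (f j)) = j" if "j \<in> {1..n}" for j
    using bij_betwE[OF bij] that bij_betw_inv_into_right[OF bij_betw_nmod[OF \<pi>] that]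
    by (auto simp: f_def)
  have f': "f (nmod (\<pi> i)) = i" if "i \<in> {1..n}" for i
    unfolding f_def using bij_betw_inv_into_left[OF bij_betw_nmod[OF \<pi>] that] .
  define \<sigma> where "\<sigma> = (\<lambda>j\<in>{1..n}. of_nat (f j) / phase (\<pi> (f j)))"
  have "\<sigma> \<in> gperms m n"
  proof (rule gpermsI)
    fix j assume j: "j \<in> {1..n}"
    obtain a where a: "phase (\<pi> (f j)) = omega m ^ a"
      using gpermsD(3)[OF \<pi> f(1)[OF j]] by blast
    have nz: "omega m \<noteq> 0"
      using norm_omega[of m] by auto
    have "a \<le> m * a"
      using assms by simp
    hence "omega m ^ (m * a - a) * omega m ^ a = 1"
      using assms omega_power_m[of m] by (simp add: power_mult flip: power_add)
    hence inv: "\<sigma> j = of_nat (f j) * omega m ^ (m * a - a)"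
      using j nz by (simp add: \<sigma>_def a field_simps)
    show "\<exists>a. phase (\<sigma> j) = omega m ^ a"
      using f(1)[OF j] by (auto simp: inv phase_mult phase_of_nat phase_omega_power)
    show "cmod (\<sigma> j) = real (f j)"
      by (simp add: inv norm_mult norm_power norm_omega)
  qed (use bij in \<open>auto simp: \<sigma>_def\<close>)
  moreover have "\<sigma> \<otimes>\<^bsub>wreath m n\<^esub> \<pi> = \<one>\<^bsub>wreath m n\<^esub>"
  proof -
    have "gapply \<sigma> (\<pi> i) = of_nat i" if "i \<in> {1..n}" for i
    proof -
      have "phase (\<pi> i) \<noteq> 0"
        using gpermsD(1,2)[OF \<pi> that] by (auto simp: phase_def)
      thus ?thesis
        using that gpermsD(1)[OF \<pi> that] by (simp add: gapply_def \<sigma>_def f')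
    qed
    thus ?thesis
      by (auto simp: wreath_def intro!: restrict_ext)
  qed
  ultimately show "\<exists>\<sigma>\<in>carrier (wreath m n). \<sigma> \<otimes>\<^bsub>wreath m n\<^esub> \<pi> = \<one>\<^bsub>wreath m n\<^esub>"
    by (auto simp: wreath_def)
qed

lemma finite_gperms:
  assumes "m \<ge> 1"
  shows "finite (gperms m n)"
proof -
  let ?Z = "(\<lambda>(a, k). omega m ^ a * of_nat k) ` ({..<m} \<times> {1..n})"
  have "gperms m n \<subseteq> PiE {1..n} (\<lambda>_. ?Z)"
  proof
    fix \<pi> assume \<pi>: "\<pi> \<in> gperms m n"
    have "\<pi> i \<in> ?Z" if i: "i \<in> {1..n}" for i
    proof -
      obtain a where a: "phase (\<pi> i) = omega m ^ a"
        using gpermsD(3)[OF \<pi> i] by blast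
      have "omega m ^ a = omega m ^ (m * (a div m) + a mod m)"
        by simp
      also have "\<dots> = omega m ^ (a mod m)"
        using omega_power_m[of m] assms by (simp only: power_add power_mult) simp
      finally have "\<pi> i = omega m ^ (a mod m) * of_nat (nmod (\<pi> i))"
        using phase_mult_nmod[OF gpermsD(2)[OF \<pi> i]] a by simp
      thus ?thesis
        using assms gpermsD(1)[OF \<pi> i] by (intro image_eqI[of _ _ "(a mod m, nmod (\<pi> i))"]) auto
    qed
    moreover have "\<pi> \<in> extensional {1..n}"
      using \<pi> by (simp add: gperms_def)
    ultimately show "\<pi> \<in> PiE {1..n} (\<lambda>_. ?Z)"
      by (simp add: PiE_iff)
  qed
  thus ?thesis
    by (rule finite_subset) (intro finite_PiE finite_imageI; simp)
qed


section \<open>The flag major index\<close>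

definition sgen :: "nat \<Rightarrow> nat \<Rightarrow> nat \<Rightarrow> (nat \<Rightarrow> complex)"
  where "sgen m n i = (\<lambda>j\<in>{1..n}.
    if i = 0 then (if j = 1 then omega m else of_nat j)
    else of_nat (if j = i then i + 1 else if j = i + 1 then i else j))"

fun tgen :: "nat \<Rightarrow> nat \<Rightarrow> nat \<Rightarrow> (nat \<Rightarrow> complex)"
  where
    "tgen m n 0 = sgen m n 0"
  | "tgen m n (Suc i) = sgen m n (Suc i) \<otimes>\<^bsub>wreath m n\<^esub> tgen m n i"

definition tword :: "nat \<Rightarrow> nat \<Rightarrow> (nat \<Rightarrow> nat) \<Rightarrow> (nat \<Rightarrow> complex)"
  where "tword m n k =
    foldr (\<lambda>i \<pi>. (tgen m n i [^]\<^bsub>wreath m n\<^esub> k i) \<otimes>\<^bsub>wreath m n\<^esub> \<pi>)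
      (rev [0..<n]) \<one>\<^bsub>wreath m n\<^esub>"

text \<open>
  Every element of the group is \<open>tword m n k\<close> for exactly one \<open>k\<close> in the product below,
  so that the definite description is proper.
\<close>

definition flag_major :: "nat \<Rightarrow> nat \<Rightarrow> (nat \<Rightarrow> complex) \<Rightarrow> nat"
  where "flag_major m n \<pi> =
    (\<Sum>i<n. (THE k. k \<in> (\<Pi>\<^sub>E i\<in>{..<n}. {..<m * (i + 1)}) \<and> tword m n k = \<pi>) i)"


section \<open>Polynomials and their tensor powers\<close>

text \<open>
  A monomial in the variables \<open>x\<^sub>j\<close> is its exponent function, and polynomials are the free vector
  space on monomials. The \<open>t\<close>-fold tensor power of polynomials is therefore the free vector space
  on \<open>t\<close>-tuples of monomials; the tuple \<open>[a\<^sub>1, \<dots>, a\<^sub>t]\<close> stands for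
  \<open>x\<^bsup>a\<^sub>1\<^esup> \<otimes> \<dots> \<otimes> x\<^bsup>a\<^sub>t\<^esup>\<close>.
\<close>

type_synonym cpoly = "(nat \<Rightarrow>\<^sub>0 nat) \<Rightarrow>\<^sub>0 complex"
type_synonym ctensor = "(nat \<Rightarrow>\<^sub>0 nat) list \<Rightarrow>\<^sub>0 complex"

definition scale :: "complex \<Rightarrow> ('a \<Rightarrow>\<^sub>0 complex) \<Rightarrow> ('a \<Rightarrow>\<^sub>0 complex)"
  where "scale c = Poly_Mapping.map ((*) c)"

lemma lookup_scale [simp]: "lookup (scale c p) a = c * lookup p a"
  by (simp add: scale_def Poly_Mapping.map.rep_eq when_def)

global_interpretation free_vs: vector_space "scale :: complex \<Rightarrow> ('a \<Rightarrow>\<^sub>0 complex) \<Rightarrow> _"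
  defines free_dim = free_vs.dim
  by unfold_locales (auto intro!: poly_mapping_eqI simp: lookup_add algebra_simps)

definition pvar :: "nat \<Rightarrow> cpoly"
  where "pvar j = Poly_Mapping.single (Poly_Mapping.single j 1) 1"

text \<open>The algebra endomorphism with \<open>x\<^sub>j \<mapsto> f j\<close>.\<close>

definition subst_hom :: "(nat \<Rightarrow> cpoly) \<Rightarrow> cpoly \<Rightarrow> cpoly"
  where "subst_hom f p = (\<Sum>a\<in>keys p. scale (lookup p a) (\<Prod>j\<in>keys a. f j ^ lookup a j))"

definition phi :: "(nat \<Rightarrow> complex) \<Rightarrow> cpoly \<Rightarrow> cpoly"
  where "phi \<pi> = subst_hom (\<lambda>j. scale (phase (\<pi> j)) (pvar (nmod (\<pi> j))))"

lemma scale_conv_mult: "scale c p = Poly_Mapping.single 0 c * p"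
  by (simp add: scale_def mult_map_scale_conv_mult)

lemma sum_single_keys:
  fixes p :: "'a \<Rightarrow>\<^sub>0 complex"
  shows "(\<Sum>a\<in>keys p. Poly_Mapping.single a (lookup p a)) = p"
proof (rule poly_mapping_eqI)
  fix b
  have "lookup (\<Sum>a\<in>keys p. Poly_Mapping.single a (lookup p a)) b
      = (\<Sum>a\<in>keys p. if a = b then lookup p b else 0)"
    unfolding lookup_sum by (rule sum.cong) (auto simp: lookup_single when_def)
  thus "lookup (\<Sum>a\<in>keys p. Poly_Mapping.single a (lookup p a)) b = lookup p b"
    by (simp add: in_keys_iff)
qed

lemma subst_hom_single:
  "subst_hom f (Poly_Mapping.single a c) = scale c (\<Prod>j\<in>keys a. f j ^ lookup a j)"
  by (cases "c = 0") (auto simp: subst_hom_def)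

lemma subst_hom_pvar [simp]: "subst_hom f (pvar j) = f j"
  by (simp add: pvar_def subst_hom_single)

lemma subst_hom_alt:
  assumes "finite A" "keys p \<subseteq> A"
  shows "subst_hom f p = (\<Sum>a\<in>A. scale (lookup p a) (\<Prod>j\<in>keys a. f j ^ lookup a j))"
  unfolding subst_hom_def
  using assms by (intro sum.mono_neutral_left) (auto simp: in_keys_iff)

lemma subst_hom_add: "subst_hom f (p + q) = subst_hom f p + subst_hom f q"
proof -
  let ?A = "keys p \<union> keys q"
  have "keys (p + q) \<subseteq> ?A"
    by (rule keys_add)
  thus ?thesis
    by (simp add: subst_hom_alt[of ?A] lookup_add free_vs.scale_left_distrib sum.distrib)
qed

lemma subst_hom_sum: "subst_hom f (\<Sum>i\<in>I. p i) = (\<Sum>i\<in>I. subst_hom f (p i))"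
proof -
  have "subst_hom f 0 = 0"
    by (simp add: subst_hom_def)
  thus ?thesis
    by (induction I rule: infinite_finite_induct) (simp_all add: subst_hom_add)
qed

lemma subst_hom_mult: "subst_hom f (p * q) = subst_hom f p * subst_hom f q"
proof -
  have single: "subst_hom f (Poly_Mapping.single a c * Poly_Mapping.single b d) =
      subst_hom f (Poly_Mapping.single a c) * subst_hom f (Poly_Mapping.single b d)" for a b c d
  proof -
    let ?K = "keys a \<union> keys b"
    have alt: "(\<Prod>j\<in>keys e. f j ^ lookup e j) = (\<Prod>j\<in>?K. f j ^ lookup e j)" if "keys e \<subseteq> ?K" for e
      using that by (intro prod.mono_neutral_left) (auto simp: in_keys_iff)
    have "(\<Prod>j\<in>keys (a + b). f j ^ lookup (a + b) j) =
        (\<Prod>j\<in>keys a. f j ^ lookup a j) * (\<Prod>j\<in>keys b. f j ^ lookup b j)"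
      unfolding alt[OF keys_add] alt[OF Un_upper1] alt[OF Un_upper2]
      by (simp add: lookup_add power_add prod.distrib)
    moreover have "Poly_Mapping.single 0 (c * d) = Poly_Mapping.single 0 c * (Poly_Mapping.single 0 d :: cpoly)"
      by (simp add: mult_single)
    ultimately show ?thesis
      by (simp add: mult_single subst_hom_single scale_conv_mult mult_ac)
  qed
  have "p * q = (\<Sum>a\<in>keys p. \<Sum>b\<in>keys q.
      Poly_Mapping.single a (lookup p a) * Poly_Mapping.single b (lookup q b))"
    by (simp add: sum_single_keys flip: sum_product)
  hence "subst_hom f (p * q) = (\<Sum>a\<in>keys p. subst_hom f (Poly_Mapping.single a (lookup p a))) *
      (\<Sum>b\<in>keys q. subst_hom f (Poly_Mapping.single b (lookup q b)))"
    by (simp add: subst_hom_sum single sum_product)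
  thus ?thesis
    by (simp add: sum_single_keys flip: subst_hom_sum)
qed

text \<open>\<open>tensor [p\<^sub>1, \<dots>, p\<^sub>t]\<close> is the pure tensor \<open>p\<^sub>1 \<otimes> \<dots> \<otimes> p\<^sub>t\<close>.\<close>

definition tensor :: "cpoly list \<Rightarrow> ctensor"
  where "tensor ps =
    (\<Sum>as\<in>listset (map keys ps). Poly_Mapping.single as (prod_list (map2 lookup ps as)))"

lemma finite_listset: "(\<And>A. A \<in> set As \<Longrightarrow> finite A) \<Longrightarrow> finite (listset As)"
  by (induction As) (auto simp: set_Cons_def intro: finite_image_set2)

lemma lookup_tensor:
  "lookup (tensor ps) as = (if length as = length ps then prod_list (map2 lookup ps as) else 0)"
proof -
  have mem: "as \<in> listset (map keys ps) \<longleftrightarrow>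
      length as = length ps \<and> prod_list (map2 lookup ps as) \<noteq> 0"
  proof (induction ps arbitrary: as)
    case (Cons p ps)
    show ?case
      using Cons.IH by (cases as) (auto simp: set_Cons_def in_keys_iff)
  qed auto
  have "lookup (tensor ps) as = (\<Sum>bs\<in>listset (map keys ps).
      if bs = as then prod_list (map2 lookup ps as) else 0)"
    unfolding tensor_def lookup_sum
    by (rule sum.cong) (auto simp: lookup_single when_def)
  moreover have "finite (listset (map keys ps))"
    by (rule finite_listset) auto
  ultimately show ?thesis
    using mem by auto
qed

text \<open>
  The linear map that sends a basis element \<open>x\<^bsup>a\<^sub>1\<^esup> \<otimes> \<dots> \<otimes> x\<^bsup>a\<^sub>t\<^esup>\<close> to
  \<open>\<phi>(g\<^sub>1)(x\<^bsup>a\<^sub>1\<^esup>) \<otimes> \<dots> \<otimes> \<phi>(g\<^sub>t)(x\<^bsup>a\<^sub>t\<^esup>)\<close>; see \<open>phiT_tensor\<close> for its effect on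
  arbitrary pure tensors.
\<close>

definition phiT :: "(nat \<Rightarrow> complex) list \<Rightarrow> ctensor \<Rightarrow> ctensor"
  where "phiT gs u = (\<Sum>as\<in>keys u. scale (lookup u as)
    (tensor (map2 (\<lambda>g a. phi g (Poly_Mapping.single a 1)) gs as)))"

lemma phi_expand:
  "lookup (phi g p) b = (\<Sum>a\<in>keys p. lookup p a * lookup (phi g (Poly_Mapping.single a 1)) b)"
  by (simp add: phi_def subst_hom_single subst_hom_def[of _ p] lookup_sum)

lemma phiT_tensor:
  assumes "length gs = length ps"
  shows "phiT gs (tensor ps) = tensor (map2 phi gs ps)"
proof (rule poly_mapping_eqI)
  fix bs
  let ?mono = "\<lambda>a. Poly_Mapping.single a 1 :: cpoly"
  let ?L = "listset (map keys ps)"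
  have fin: "finite ?L"
    by (rule finite_listset) auto
  have len: "length as = length ps" if "as \<in> ?L" for as
    using that by (induction ps arbitrary: as) (auto simp: set_Cons_def)
  have keys: "keys (tensor ps) \<subseteq> ?L"
    unfolding tensor_def by (rule order.trans[OF keys_sum]) auto
  have "lookup (phiT gs (tensor ps)) bs = (\<Sum>as\<in>keys (tensor ps).
      lookup (tensor ps) as * lookup (tensor (map2 (\<lambda>g a. phi g (?mono a)) gs as)) bs)"
    by (simp add: phiT_def lookup_sum)
  also have "\<dots> = (\<Sum>as\<in>?L.
      lookup (tensor ps) as * lookup (tensor (map2 (\<lambda>g a. phi g (?mono a)) gs as)) bs)"
    using keys fin by (intro sum.mono_neutral_left) (auto simp: in_keys_iff)
  also have "\<dots> = lookup (tensor (map2 phi gs ps)) bs"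
  proof (cases "length bs = length ps")
    case False
    thus ?thesis
      using assms len by (auto simp: lookup_tensor)
  next
    case True
    have "(\<Sum>as\<in>?L. prod_list (map2 lookup ps as) *
        prod_list (map2 lookup (map2 (\<lambda>g a. phi g (?mono a)) gs as) bs)) =
        prod_list (map2 lookup (map2 phi gs ps) bs)"
      using assms True[symmetric]
    proof (induction gs ps bs rule: list_induct3)
      case (Cons g gs p ps b bs)
      let ?M = "listset (map keys ps)"
      let ?F = "\<lambda>as. prod_list (map2 lookup ps as) *
        prod_list (map2 lookup (map2 (\<lambda>g a. phi g (?mono a)) gs as) bs)"
      have img: "listset (map keys (p # ps)) = (\<lambda>(a, as). a # as) ` (keys p \<times> ?M)"
        by (auto simp: set_Cons_def)
      have inj: "inj_on (\<lambda>(a, as). a # as) (keys p \<times> ?M)"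
        by (auto simp: inj_on_def)
      have "(\<Sum>as\<in>listset (map keys (p # ps)). prod_list (map2 lookup (p # ps) as) *
          prod_list (map2 lookup (map2 (\<lambda>g a. phi g (?mono a)) (g # gs) as) (b # bs))) =
          (\<Sum>(a, as)\<in>keys p \<times> ?M. (lookup p a * lookup (phi g (?mono a)) b) * ?F as)"
        unfolding img by (subst sum.reindex[OF inj]) (auto intro!: sum.cong)
      also have "\<dots> = (\<Sum>a\<in>keys p. lookup p a * lookup (phi g (?mono a)) b) * (\<Sum>as\<in>?M. ?F as)"
        by (simp add: sum_product sum.cartesian_product)
      finally show ?case
        by (simp add: Cons.IH flip: phi_expand)
    qed auto
    thus ?thesis
      using assms True len by (simp add: lookup_tensor)
  qed
  finally show "lookup (phiT gs (tensor ps)) bs = lookup (tensor (map2 phi gs ps)) bs" .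
qed

definition tensor_power :: "nat \<Rightarrow> nat \<Rightarrow> ctensor set"
  where "tensor_power n t =
    {u. \<forall>as\<in>keys u. length as = t \<and> (\<forall>a\<in>set as. keys a \<subseteq> {1..n})}"

definition TIA :: "nat \<Rightarrow> nat \<Rightarrow> nat \<Rightarrow> ctensor set"
  where "TIA m n t = {p \<in> tensor_power n t.
    \<forall>gs. length gs = t \<and> set gs \<subseteq> carrier (wreath m n) \<longrightarrow> phiT gs p = p}"

definition DIA :: "nat \<Rightarrow> nat \<Rightarrow> nat \<Rightarrow> ctensor set"
  where "DIA m n t = {p \<in> tensor_power n t.
    \<forall>g\<in>carrier (wreath m n). phiT (replicate t g) p = p}"


section \<open>Hilbert series\<close>

definition homogeneous_piece :: "ctensor set \<Rightarrow> (nat \<Rightarrow>\<^sub>0 nat) \<Rightarrow> ctensor set"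
  where "homogeneous_piece A k =
    {p \<in> A. \<forall>as\<in>keys p. Poly_Mapping.nth (map mono_deg as) = k}"

definition hilbert_series :: "ctensor set \<Rightarrow> rat mfps"
  where "hilbert_series A = Abs_mfps (\<lambda>k. of_nat (free_dim (homogeneous_piece A k)))"

definition F_D :: "nat \<Rightarrow> nat \<Rightarrow> nat \<Rightarrow> rat mfps"
  where "F_D m n t = hilbert_series (DIA m n t)"

definition F_T :: "nat \<Rightarrow> nat \<Rightarrow> nat \<Rightarrow> rat mfps"
  where "F_T m n t = hilbert_series (TIA m n t)"

end

theory Submission
  imports Defs "HOL-Library.Multiset" "HOL-Library.List_Lexorder"
begin

text \<open>
  Write \<open>|g|\<close> for the permutation \<open>j \<mapsto> |g(j)|\<close> underlying \<open>g \<in> G\<close>; the other datum of \<open>g\<close> is the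
  list of phases \<open>g(j) / |g(j)|\<close>. The group permutes the monomials up to roots of unity, so each of the
  two invariant algebras has a basis of orbit sums of \<open>t\<close>-tuples of monomials, taken over the orbits on
  which all these roots of unity are 1. Reading a monomial as its sequence of exponents
  \<open>(a(1), \<dots>, a(n))\<close>, each orbit has exactly one sorted representative. For \<open>TIA\<close> these are the tuples
  of weakly decreasing sequences all of whose entries are divisible by \<open>m\<close>. For \<open>DIA\<close> they are the
  tuples \<open>(a\<^sub>1, \<dots>, a\<^sub>t)\<close> for which every sum \<open>a\<^sub>1(j) + \<dots> + a\<^sub>t(j)\<close> is divisible by \<open>m\<close> and whose columns
  \<open>(a\<^sub>t(j), \<dots>, a\<^sub>1(j))\<close> decrease lexicographically in \<open>j\<close>. The Hilbert series count these tuples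
  (\<open>dim_TIA\<close>, \<open>dim_DIA\<close>), and the theorem becomes a statement about sorting, in the spirit of Garsia and
  Gessel.

  Call a sequence \<open>l\<close> compatible with \<open>g\<close> if it decreases weakly, decreases strictly wherever \<open>|g|\<close>
  does, and satisfies \<open>\<omega>\<^bsup>l(p)\<^esup> = g(p) / |g(p)|\<close>. The sequences compatible with 1 are the building blocks of
  \<open>TIA\<close>. Two facts carry the proof.

  First, the sequences compatible with \<open>g\<close> are those compatible with 1, translated by one fixed sequence
  of sum \<open>flag-major(g)\<close> (\<open>compatible_flag_major\<close>). The definition of the flag major index makes this
  a statement about left multiplication by a single \<open>t\<^sub>i\<close>, which lowers the values \<open>2, \<dots>, i + 1\<close> by one
  and turns the value 1 into \<open>\<omega>(i + 1)\<close>: the compatible sequences then grow by 1 at the position of the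
  value 1, and nothing else happens (\<open>compatible_tgen_mult\<close>).

  Second, rank the positions by decreasing entries of a sequence \<open>a\<close>, with ties broken by \<open>|g|\<close>. The
  ranking, with suitable phases, is an element \<open>h\<close>, and the sorted form of \<open>a\<close> is compatible with
  \<open>g h\<^bsup>-1\<^esup>\<close> (\<open>compatible_iff_refines\<close>). So sorting \<open>a\<close> splits off one factor of \<open>g\<close> together with a
  sequence compatible with that factor, and \<open>h\<close> takes the role of \<open>g\<close> for the next sequence. Starting
  from \<open>g = 1\<close> and treating \<open>a\<^sub>1, \<dots>, a\<^sub>t\<close> in turn gives elements \<open>g\<^sub>1, \<dots>, g\<^sub>t\<close> and sequences \<open>l\<^sub>i\<close>, where
  \<open>l\<^sub>i\<close> is the sorted form of \<open>a\<^sub>i\<close> and is compatible with \<open>g\<^sub>i\<close>. The last \<open>h\<close> is the identity, so that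
  \<open>g\<^sub>1 \<cdots> g\<^sub>t = 1\<close>, exactly if the tuple is one of the sorted tuples that index the basis of \<open>DIA\<close>
  (\<open>bij_betw_glue\<close>).

  Together: sorted tuples of \<open>DIA\<close> correspond to pairs of a factorization of 1 and a sorted tuple of
  \<open>TIA\<close>, and the \<open>i\<close>-th degrees differ by \<open>flag-major(g\<^sub>i)\<close>. This is the assertion multiplied by \<open>F\<^sub>T\<close>,
  whose constant coefficient is nonzero.
\<close>

section \<open>Moduli and phases of generalized permutations\<close>

lemma omega_nonzero: "omega m \<noteq> 0"
  using norm_omega[of m] by auto

lemma omega_power_eq_1_iff:
  assumes "m \<ge> 1" "k < m"
  shows "omega m ^ k = 1 \<longleftrightarrow> k = 0"
proof
  assume one: "omega m ^ k = 1"
  have "2 * of_real pi * \<i> / of_nat m = \<i> * of_real (2 * pi / real m)"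
    by simp
  hence "omega m = cis (2 * pi / real m)"
    unfolding omega_def by (simp only: cis_conv_exp)
  hence "omega m ^ k = cis (real k * (2 * pi / real m))"
    by (simp only: DeMoivre)
  with one have "cos (real k * (2 * pi / real m)) = 1"
    by (metis cis.sel(1) one_complex.sel(1))
  then obtain j :: nat where "real k * (2 * pi / real m) = real j * 2 * pi \<or>
      real k * (2 * pi / real m) = - (real j * 2 * pi)"
    unfolding cos_one_2pi by blast
  moreover have "real k * (2 * pi / real m) = (real k / real m) * (2 * pi)"
    by simp
  ultimately have "(real k / real m) * (2 * pi) = real j * (2 * pi) \<or>
      (real k / real m) * (2 * pi) = (- real j) * (2 * pi)"
    by (simp only: mult.assoc mult_minus_left)
  hence "real k / real m = real j \<or> real k / real m = - real j"
    unfolding mult_cancel_right by simp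
  hence "real k = real (j * m) \<or> real k = - real (j * m)"
    using assms(1) by (auto simp: divide_eq_eq)
  hence "k = j * m \<or> k = 0"
    by linarith
  thus "k = 0"
    using assms by auto
qed simp

lemma omega_power_inj:
  assumes "m \<ge> 1" "j < m" "k < m" "omega m ^ j = omega m ^ k"
  shows "j = k"
  using assms
proof (induction j k rule: linorder_wlog)
  case (le j k)
  have "omega m ^ j * omega m ^ (k - j) = omega m ^ (j + (k - j))"
    by (rule power_add [symmetric])
  hence "omega m ^ j * omega m ^ (k - j) = omega m ^ j * 1"
    using le by simp
  hence "omega m ^ (k - j) = 1"
    using omega_nonzero by simp
  thus ?case
    using le omega_power_eq_1_iff[of m "k - j"] by simp
qed auto

locale cyclic_wreath =
  fixes m n :: nat
  assumes m_pos: "m \<ge> 1"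
begin

abbreviation "G \<equiv> wreath m n"

sublocale group G
  by (rule group_wreath[OF m_pos])

lemma carrier_G: "carrier G = gperms m n"
  by (simp add: wreath_def)

lemma finite_carrier: "finite (carrier G)"
  using finite_gperms[OF m_pos] by (simp add: carrier_G)

lemma nmod_in: "g \<in> carrier G \<Longrightarrow> j \<in> {1..n} \<Longrightarrow> nmod (g j) \<in> {1..n}"
  by (metis carrier_G gpermsD(1))

lemma bij_nmod: "g \<in> carrier G \<Longrightarrow> bij_betw (\<lambda>j. nmod (g j)) {1..n} {1..n}"
  unfolding carrier_G by (rule bij_betw_nmod)

lemma nmod_inj:
  "g \<in> carrier G \<Longrightarrow> i \<in> {1..n} \<Longrightarrow> j \<in> {1..n} \<Longrightarrow> nmod (g i) = nmod (g j) \<longleftrightarrow> i = j"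
  using bij_nmod[of g] by (auto simp: bij_betw_def dest: inj_onD)

lemma nmod_surj:
  assumes "g \<in> carrier G" "p \<in> {1..n}"
  obtains j where "j \<in> {1..n}" "nmod (g j) = p"
proof -
  have "p \<in> (\<lambda>j. nmod (g j)) ` {1..n}"
    using bij_betw_imp_surj_on[OF bij_nmod[OF assms(1)]] assms(2) by simp
  thus ?thesis
    using that by blast
qed

lemma phase_nmod: "g \<in> carrier G \<Longrightarrow> j \<in> {1..n} \<Longrightarrow> phase (g j) * of_nat (nmod (g j)) = g j"
  by (metis carrier_G gpermsD(2) phase_mult_nmod)

lemma phase_is_power: "g \<in> carrier G \<Longrightarrow> j \<in> {1..n} \<Longrightarrow> \<exists>a. phase (g j) = omega m ^ a"
  by (metis carrier_G gpermsD(3))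

lemma phase_nonzero: "g \<in> carrier G \<Longrightarrow> j \<in> {1..n} \<Longrightarrow> phase (g j) \<noteq> 0"
  using phase_is_power[of g j] omega_nonzero by auto

lemma mult_apply: "j \<in> {1..n} \<Longrightarrow> (g \<otimes>\<^bsub>G\<^esub> h) j = phase (h j) * g (nmod (h j))"
  by (simp add: wreath_def gapply_def)

lemma nmod_mult:
  assumes "g \<in> carrier G" "h \<in> carrier G" "j \<in> {1..n}"
  shows "nmod ((g \<otimes>\<^bsub>G\<^esub> h) j) = nmod (g (nmod (h j)))"
proof -
  obtain a where "phase (h j) = omega m ^ a"
    using phase_is_power assms by blast
  thus ?thesis
    using assms by (simp add: mult_apply nmod_def norm_mult norm_power norm_omega)
qed

lemma phase_mult_G:
  assumes "g \<in> carrier G" "h \<in> carrier G" "j \<in> {1..n}"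
  shows "phase ((g \<otimes>\<^bsub>G\<^esub> h) j) = phase (h j) * phase (g (nmod (h j)))"
proof -
  obtain a where "phase (h j) = omega m ^ a"
    using phase_is_power assms by blast
  thus ?thesis
    using assms by (simp add: mult_apply phase_mult phase_omega_power)
qed

lemma one_apply: "j \<in> {1..n} \<Longrightarrow> \<one>\<^bsub>G\<^esub> j = of_nat j"
  by (simp add: wreath_def)

lemma nmod_of_nat [simp]: "nmod (of_nat k) = k"
  by (simp add: nmod_def)

lemma nmod_one [simp]: "j \<in> {1..n} \<Longrightarrow> nmod (\<one>\<^bsub>G\<^esub> j) = j"
  by (simp add: one_apply)

lemma phase_one [simp]: "j \<in> {1..n} \<Longrightarrow> phase (\<one>\<^bsub>G\<^esub> j) = 1"
  by (simp add: one_apply phase_of_nat)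

lemma wreath_eqI:
  assumes "g \<in> carrier G" "h \<in> carrier G"
    and "\<And>j. j \<in> {1..n} \<Longrightarrow> nmod (g j) = nmod (h j)"
    and "\<And>j. j \<in> {1..n} \<Longrightarrow> phase (g j) = phase (h j)"
  shows "g = h"
proof (rule extensionalityI[of _ "{1..n}"])
  show "g \<in> extensional {1..n}" "h \<in> extensional {1..n}"
    using assms(1,2) by (auto simp: carrier_G gperms_def)
  show "g j = h j" if "j \<in> {1..n}" for j
    using phase_nmod[OF assms(1) that] phase_nmod[OF assms(2) that] assms(3,4)[OF that] by metis
qed

lemma ex_wreath:
  assumes "bij_betw s {1..n} {1..n}"
  obtains g where "g \<in> carrier G"
    "\<And>j. j \<in> {1..n} \<Longrightarrow> nmod (g j) = s j"
    "\<And>j. j \<in> {1..n} \<Longrightarrow> phase (g j) = omega m ^ c j"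
proof
  let ?g = "\<lambda>j\<in>{1..n}. omega m ^ c j * of_nat (s j)"
  have s: "s j > 0" if "j \<in> {1..n}" for j
    using bij_betwE[OF assms] that by fastforce
  show "?g \<in> carrier G"
    unfolding carrier_G
    by (rule gpermsI[where f = s])
       (use assms s in \<open>auto simp: norm_mult norm_power norm_omega phase_mult phase_omega_power phase_of_nat\<close>)
  show "nmod (?g j) = s j" if "j \<in> {1..n}" for j
    using that by (simp add: nmod_def norm_mult norm_power norm_omega)
  show "phase (?g j) = omega m ^ c j" if "j \<in> {1..n}" for j
    using that s by (simp add: phase_mult phase_omega_power phase_of_nat)
qed


section \<open>Powers of the elements \<open>t\<^sub>i\<close>\<close>

lemma sgen_closed:
  assumes "i < n"
  shows "sgen m n i \<in> carrier G"
  unfolding carrier_G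
proof (rule gpermsI[where f = "\<lambda>j. if i = 0 then j else if j = i then i + 1 else if j = i + 1 then i else j"])
  show "sgen m n i \<in> extensional {1..n}"
    by (simp add: sgen_def)
  fix j assume j: "j \<in> {1..n}"
  show "\<exists>a. phase (sgen m n i j) = omega m ^ a"
  proof (cases "i = 0 \<and> j = 1")
    case True
    thus ?thesis
      using j phase_omega_power[of m 1] by (auto simp: sgen_def intro: exI[of _ 1])
  next
    case False
    thus ?thesis
      using j by (intro exI[of _ 0]) (auto simp: sgen_def phase_of_nat simp del: of_nat_Suc of_nat_add of_nat_diff)
  qed
  show "cmod (sgen m n i j) = real (if i = 0 then j else if j = i then i + 1 else if j = i + 1 then i else j)"
    using j by (auto simp: sgen_def norm_omega simp del: of_nat_Suc of_nat_add of_nat_diff)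
next
  show "bij_betw (\<lambda>j. if i = 0 then j else if j = i then i + 1 else if j = i + 1 then i else j) {1..n} {1..n}"
    using assms
    by (intro bij_betwI[where g = "\<lambda>j. if i = 0 then j else if j = i then i + 1 else if j = i + 1 then i else j"])
       (auto split: if_splits)
qed

lemma tgen_closed: "i < n \<Longrightarrow> tgen m n i \<in> carrier G"
  by (induction i) (auto intro: sgen_closed)

lemma tgen_apply:
  assumes "i < n" "j \<in> {1..n}"
  shows "tgen m n i j =
    (if j = 1 then omega m * of_nat (i + 1) else of_nat (if j \<le> i + 1 then j - 1 else j))"
  using assms
proof (induction i)
  case 0
  thus ?case by (auto simp: sgen_def)
next
  case (Suc i)
  have nm: "nmod (omega m * of_nat k) = k" for k
    by (simp add: nmod_def norm_mult norm_omega)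
  have ph: "phase (omega m * of_nat k) = omega m" if "k > 0" for k
    using that phase_omega_power[of m 1] by (simp add: phase_mult phase_of_nat)
  have "tgen m n (Suc i) j = phase (tgen m n i j) * sgen m n (Suc i) (nmod (tgen m n i j))"
    using Suc.prems by (simp add: mult_apply)
  also have "tgen m n i j =
    (if j = 1 then omega m * of_nat (i + 1) else of_nat (if j \<le> i + 1 then j - 1 else j))"
    using Suc by simp
  finally show ?case
    using Suc.prems nm[of "i + 1"] ph[of "i + 1"]
    by (auto simp: sgen_def phase_of_nat simp del: of_nat_Suc of_nat_add of_nat_diff)
qed

lemma nmod_tgen:
  assumes "i < n" "j \<in> {1..n}"
  shows "nmod (tgen m n i j) = (if j = 1 then i + 1 else if j \<le> i + 1 then j - 1 else j)"
  using assms by (auto simp: tgen_apply nmod_def norm_mult norm_omega simp del: of_nat_Suc of_nat_add of_nat_diff)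

lemma phase_tgen:
  assumes "i < n" "j \<in> {1..n}"
  shows "phase (tgen m n i j) = (if j = 1 then omega m else 1)"
  using assms phase_omega_power[of m 1]
  by (auto simp: tgen_apply phase_mult phase_of_nat simp del: of_nat_Suc of_nat_add of_nat_diff)

text \<open>
  The value at \<open>i + 1\<close> determines the exponent \<open>k < m(i + 1)\<close>. This is what makes the representation
  by powers of the \<open>t\<^sub>i\<close> unique, and it bounds how often \<open>t\<^sub>i\<close> can be applied before the position
  \<open>i + 1\<close> is fixed again.
\<close>

lemma tgen_pow_apply:
  assumes "i < n"
  shows "(tgen m n i [^]\<^bsub>G\<^esub> k) (i + 1) =
    omega m ^ (k div (i + 1)) * of_nat (i + 1 - k mod (i + 1))"
proof (induction k)
  case 0
  thus ?case using assms by (simp add: one_apply)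
next
  case (Suc k)
  let ?t = "tgen m n i" and ?r = "i + 1 - k mod (i + 1)"
  have t: "?t \<in> carrier G"
    using assms by (rule tgen_closed)
  have r: "k mod (i + 1) < i + 1"
    by simp
  have r': "?r \<in> {1..n}"
    using assms r by (simp only: atLeastAtMost_iff) linarith
  have 1: "phase ((?t [^]\<^bsub>G\<^esub> k) (i + 1)) = omega m ^ (k div (i + 1))"
    unfolding Suc using r by (simp add: phase_mult phase_of_nat phase_omega_power del: of_nat_diff)
  have 2: "nmod ((?t [^]\<^bsub>G\<^esub> k) (i + 1)) = ?r"
    unfolding Suc using r by (simp add: nmod_def norm_mult norm_power norm_omega del: of_nat_diff)
  \<comment> \<open>The orbit of \<open>i + 1\<close> runs down to 1 and then jumps to \<open>\<omega>(i + 1)\<close>, so \<open>k div (i + 1)\<close> counts the jumps.\<close>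
  have "(?t [^]\<^bsub>G\<^esub> Suc k) (i + 1) = omega m ^ (k div (i + 1)) * ?t ?r"
    using assms t 1 2 by (simp only: nat_pow_Suc2 mult_apply) (simp add: mult_apply)
  also have "?t ?r = (if ?r = 1 then omega m * of_nat (i + 1) else of_nat (?r - 1))"
    using assms r' by (subst tgen_apply) auto
  finally have *: "(?t [^]\<^bsub>G\<^esub> Suc k) (i + 1) = omega m ^ (k div (i + 1)) *
    (if ?r = 1 then omega m * of_nat (i + 1) else of_nat (?r - 1))" .
  show ?case
  proof (cases "Suc (k mod (i + 1)) = i + 1")
    case True
    thus ?thesis
      unfolding * by (simp add: mod_Suc div_Suc)
  next
    case False
    with r have "?r \<noteq> 1" "?r - 1 = i + 1 - Suc (k mod (i + 1))"
      by linarith+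
    with False show ?thesis
      unfolding * by (simp add: mod_Suc div_Suc del: of_nat_diff)
  qed
qed


section \<open>Sequences compatible with a generalized permutation\<close>

text \<open>
  The condition on \<open>p < q\<close> ranges over all pairs, not only adjacent positions, so that it
  carries over to any rearrangement of the positions.
\<close>

definition compatible :: "(nat \<Rightarrow> complex) \<Rightarrow> (nat \<Rightarrow>\<^sub>0 nat) set" where
  "compatible g = {l. keys l \<subseteq> {1..n} \<and>
     (\<forall>p\<in>{1..n}. phase (g p) = omega m ^ lookup l p) \<and>
     (\<forall>p\<in>{1..n}. \<forall>q\<in>{1..n}. p < q \<longrightarrow>
        lookup l p > lookup l q \<or> (lookup l p = lookup l q \<and> nmod (g p) < nmod (g q)))}"

definition fixes_above :: "nat \<Rightarrow> (nat \<Rightarrow> complex) \<Rightarrow> bool" where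
  "fixes_above N g \<longleftrightarrow> (\<forall>q\<in>{1..n}. q > N \<longrightarrow> g q = of_nat q)"

lemma fixes_above_nmod:
  assumes "g \<in> carrier G" "fixes_above N g" "p \<in> {1..n}"
  shows "nmod (g p) > N \<longleftrightarrow> p > N"
proof
  assume less: "nmod (g p) > N"
  have q: "nmod (g p) \<in> {1..n}"
    using assms by (simp only: nmod_in)
  hence "nmod (g (nmod (g p))) = nmod (g p)"
    using assms(2) less by (simp add: fixes_above_def)
  hence "nmod (g p) = p"
    using nmod_inj[OF assms(1) q assms(3)] by blast
  thus "p > N"
    using less by simp
next
  assume "p > N"
  thus "nmod (g p) > N"
    using assms by (simp add: fixes_above_def)
qed

text \<open>
  The heart of the connection with the flag major index. If \<open>p\<close> is the position of the value 1 of \<open>g\<close>,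
  then the phase at \<open>p\<close> gains a factor \<open>\<omega>\<close> and \<open>p\<close> changes from the position of the smallest value to
  that of the largest among the first \<open>i + 1\<close> positions, while all other comparisons stay the same.
  Hence raising the entry at \<open>p\<close> by 1 preserves compatibility: a strict descent before \<open>p\<close>
  may become weak, and a weak descent after \<open>p\<close> becomes strict. Conversely the entry at \<open>p\<close> of a
  sequence compatible with \<open>t\<^sub>i g\<close> can be lowered, because it exceeds all later entries and 0;
  this fails only when \<open>p = i + 1\<close> and the new phase at \<open>p\<close> is 1, that is, when \<open>t\<^sub>i g\<close>
  fixes \<open>i + 1\<close>.
\<close>

lemma compatible_tgen_mult:
  assumes i: "i < n" and g: "g \<in> carrier G" and fixed: "fixes_above (i + 1) g"
    and moved: "(tgen m n i \<otimes>\<^bsub>G\<^esub> g) (i + 1) \<noteq> of_nat (i + 1)"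
  obtains p where "compatible (tgen m n i \<otimes>\<^bsub>G\<^esub> g) = (+) (Poly_Mapping.single p 1) ` compatible g"
proof -
  let ?t = "tgen m n i" let ?h = "?t \<otimes>\<^bsub>G\<^esub> g"
  have t: "?t \<in> carrier G"
    using i by (rule tgen_closed)
  obtain p where p: "p \<in> {1..n}" "nmod (g p) = 1"
    using nmod_surj[OF g, of 1] i by auto
  have one: "nmod (g q) = 1 \<longleftrightarrow> q = p" if "q \<in> {1..n}" for q
    using nmod_inj[OF g that p(1)] p(2) by simp
  have ge: "nmod (g q) \<ge> 1" if "q \<in> {1..n}" for q
    using nmod_in[OF g that] by simp
  have p_le: "p \<le> i + 1"
    using fixes_above_nmod[OF g fixed p(1)] p(2) by simp
  have nh: "nmod (?h q) = (if q = p then i + 1 else if q \<le> i + 1 then nmod (g q) - 1 else q)"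
    if "q \<in> {1..n}" for q
    using that i nmod_in[OF g that] one[OF that] fixes_above_nmod[OF g fixed that] fixed
    by (auto simp: nmod_mult[OF t g that] nmod_tgen fixes_above_def)
  have ph: "phase (?h q) = (if q = p then phase (g q) * omega m else phase (g q))"
    if "q \<in> {1..n}" for q
    using that i nmod_in[OF g that] one[OF that]
    by (simp add: phase_mult_G[OF t g that] phase_tgen)
  have small: "nmod (g q) \<le> i + 1 \<longleftrightarrow> q \<le> i + 1" if "q \<in> {1..n}" for q
    using fixes_above_nmod[OF g fixed that] by linarith
  have big: "nmod (g q) = q" if "q \<in> {1..n}" "q > i + 1" for q
    using fixed that by (simp add: fixes_above_def)
  have less: "nmod (?h q) < nmod (?h q') \<longleftrightarrow> nmod (g q) < nmod (g q')"
    if "q \<in> {1..n}" "q' \<in> {1..n}" "q \<noteq> p" "q' \<noteq> p" for q q'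
    using that one[of q] one[of q'] ge[of q] ge[of q'] small[of q] small[of q'] big[of q] big[of q']
    unfolding nh[OF that(1)] nh[OF that(2)] by auto
  let ?e = "Poly_Mapping.single p 1 :: nat \<Rightarrow>\<^sub>0 nat"
  have add: "?e + l \<in> compatible ?h" if l: "l \<in> compatible g" for l
  proof -
    have ord: "lookup l q > lookup l q' \<or> (lookup l q = lookup l q' \<and> nmod (g q) < nmod (g q'))"
      if "q \<in> {1..n}" "q' \<in> {1..n}" "q < q'" for q q'
      using l that by (auto simp: compatible_def)
    have "lookup (?e + l) q > lookup (?e + l) q' \<or>
        (lookup (?e + l) q = lookup (?e + l) q' \<and> nmod (?h q) < nmod (?h q'))"
      if q: "q \<in> {1..n}" "q' \<in> {1..n}" "q < q'" for q q'
    proof -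
      consider "q = p" | "q' = p" | "q \<noteq> p" "q' \<noteq> p" by blast
      thus ?thesis
      proof cases
        case 1
        thus ?thesis
          using ord[OF q] q(3) by (auto simp: lookup_add lookup_single)
      next
        case 2
        have "lookup l q > lookup l p"
          using ord[OF q] 2 p(2) ge[OF q(1)] by auto
        moreover have "nmod (?h q) < nmod (?h p)"
          using q 2 p_le ge[OF q(1)] small[OF q(1)] unfolding nh[OF q(1)] nh[OF p(1)] by auto
        ultimately show ?thesis
          using q(3) 2 by (auto simp: lookup_add lookup_single)
      next
        case 3
        thus ?thesis
          using ord[OF q] less[OF q(1,2)] by (auto simp: lookup_add lookup_single)
      qed
    qed
    moreover have "phase (?h q) = omega m ^ lookup (?e + l) q" if "q \<in> {1..n}" for q
      using l that by (simp add: ph compatible_def lookup_add lookup_single when_def)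
    moreover have "keys (?e + l) \<subseteq> {1..n}"
      using l p(1) keys_add[of ?e l] by (auto simp: compatible_def split: if_splits)
    ultimately show ?thesis
      by (simp add: compatible_def)
  qed
  have sub: "l' \<in> (+) ?e ` compatible g" if l': "l' \<in> compatible ?h" for l'
  proof -
    have ord: "lookup l' q > lookup l' q' \<or> (lookup l' q = lookup l' q' \<and> nmod (?h q) < nmod (?h q'))"
      if "q \<in> {1..n}" "q' \<in> {1..n}" "q < q'" for q q'
      using l' that by (auto simp: compatible_def)
    have ph': "phase (?h q) = omega m ^ lookup l' q" if "q \<in> {1..n}" for q
      using l' that by (auto simp: compatible_def)
    \<comment> \<open>On the first \<open>i + 1\<close> positions \<open>|t\<^sub>i g|\<close> is largest at \<open>p\<close>.\<close>
    have strict_low: "lookup l' p > lookup l' q" if "q \<in> {1..n}" "p < q" "q \<le> i + 1" for q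
      using ord[OF p(1) that(1,2)] that small[OF that(1)] one[OF that(1)] ge[OF that(1)]
      unfolding nh[OF p(1)] nh[OF that(1)] by auto
    have last: "i + 1 \<in> {1..n}"
      using i by simp
    have p_strict: "p < i + 1" if "phase (?h p) = 1"
    proof (rule ccontr)
      assume "\<not> p < i + 1"
      with p_le have "p = i + 1" by simp
      hence "?h (i + 1) = of_nat (i + 1)"
        using phase_nmod[OF m_closed[OF t g] p(1)] that nh[OF p(1)] by simp
      with moved show False by contradiction
    qed
    have pos: "lookup l' p > 0"
    proof (rule ccontr)
      assume "\<not> lookup l' p > 0"
      hence 0: "lookup l' p = 0" by simp
      hence "phase (?h p) = 1"
        using ph'[OF p(1)] by simp
      thus False
        using strict_low[OF last] p_strict 0 by simp
    qed
    \<comment> \<open>Beyond position \<open>i + 1\<close> all phases are 1, so an equal entry would force phase 1 at \<open>p\<close>.\<close>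
    have strict: "lookup l' p > lookup l' q" if q: "q \<in> {1..n}" "p < q" for q
    proof (cases "q \<le> i + 1")
      case True
      thus ?thesis using strict_low q by simp
    next
      case False
      have "phase (g q) = 1"
        using fixed False q by (simp add: fixes_above_def phase_of_nat)
      hence 1: "omega m ^ lookup l' q = 1"
        using ph'[OF q(1)] ph[OF q(1)] q(2) by simp
      show ?thesis
      proof (rule ccontr)
        assume "\<not> ?thesis"
        hence eq: "lookup l' p = lookup l' q"
          using ord[OF p(1) q] by auto
        hence "phase (?h p) = 1"
          using ph'[OF p(1)] 1 by simp
        hence "lookup l' (i + 1) < lookup l' p"
          using strict_low[OF last] p_strict by simp
        moreover have "lookup l' q \<le> lookup l' (i + 1)"
          using ord[OF last q(1)] False by auto
        ultimately show False
          using eq by simp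
      qed
    qed
    define l where "l = l' - ?e"
    have l: "lookup l q = (if q = p then lookup l' q - 1 else lookup l' q)" for q
      by (simp add: l_def lookup_minus lookup_single when_def)
    have l'_eq: "l' = ?e + l"
      by (rule poly_mapping_eqI) (use pos in \<open>auto simp: lookup_add l lookup_single when_def\<close>)
    have "lookup l q > lookup l q' \<or> (lookup l q = lookup l q' \<and> nmod (g q) < nmod (g q'))"
      if q: "q \<in> {1..n}" "q' \<in> {1..n}" "q < q'" for q q'
    proof -
      consider "q = p" | "q' = p" | "q \<noteq> p" "q' \<noteq> p" by blast
      thus ?thesis
      proof cases
        case 1
        have "nmod (g p) < nmod (g q')"
          using p(2) one[OF q(2)] ge[OF q(2)] q(3) 1 by simp
        moreover have "lookup l' q' < lookup l' p"
          using strict[OF q(2)] q(3) 1 by simp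
        ultimately show ?thesis
          using q(3) 1 pos by (auto simp: l)
      next
        case 2
        have "lookup l' p \<le> lookup l' q"
          using ord[OF q] 2 by auto
        hence "lookup l' p - 1 < lookup l' q"
          using pos by linarith
        thus ?thesis
          using q(3) 2 by (simp add: l)
      next
        case 3
        thus ?thesis
          using ord[OF q] less[OF q(1,2)] by (simp add: l)
      qed
    qed
    moreover have "phase (g q) = omega m ^ lookup l q" if q: "q \<in> {1..n}" for q
    proof (cases "q = p")
      case True
      have "phase (g p) * omega m = omega m ^ (lookup l p + 1)"
        using ph[OF p(1)] ph'[OF p(1)] pos by (simp add: l)
      thus ?thesis
        using True omega_nonzero by simp
    next
      case False
      thus ?thesis using ph[OF q] ph'[OF q] by (simp add: l)
    qed
    moreover have "keys l \<subseteq> {1..n}"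
    proof
      fix q assume "q \<in> keys l"
      hence "q \<in> keys l'"
        by (auto simp: in_keys_iff l split: if_splits)
      thus "q \<in> {1..n}"
        using l' by (auto simp: compatible_def)
    qed
    ultimately have "l \<in> compatible g"
      by (simp add: compatible_def)
    thus ?thesis
      unfolding l'_eq by (rule imageI)
  qed
  show ?thesis
    using that add sub by blast
qed

end

section \<open>The flag major index\<close>

lemma mono_deg_superset:
  assumes "finite A" "keys l \<subseteq> A"
  shows "mono_deg l = (\<Sum>j\<in>A. lookup l j)"
  unfolding mono_deg_def
  by (rule sum.mono_neutral_left) (use assms in \<open>auto simp: in_keys_iff\<close>)

lemma mono_deg_add: "mono_deg (a + b) = mono_deg a + mono_deg b"
proof -
  let ?A = "keys a \<union> keys b"
  have "mono_deg (a + b) = (\<Sum>j\<in>?A. lookup (a + b) j)"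
    by (rule mono_deg_superset) (use keys_add[of a b] in auto)
  also have "\<dots> = mono_deg a + mono_deg b"
    using mono_deg_superset[of ?A a] mono_deg_superset[of ?A b] by (simp add: lookup_add sum.distrib)
  finally show ?thesis .
qed

lemma mono_deg_single [simp]: "mono_deg (Poly_Mapping.single p k) = k"
  by (cases "k = 0") (auto simp: mono_deg_def)

lemma mono_deg_zero [simp]: "mono_deg 0 = 0"
  by (simp add: mono_deg_def)

context cyclic_wreath
begin

lemma fixes_above_mult:
  assumes "fixes_above N g" "fixes_above N h"
  shows "fixes_above N (g \<otimes>\<^bsub>G\<^esub> h)"
  using assms by (auto simp: fixes_above_def mult_apply phase_of_nat)

lemma fixes_above_mono: "fixes_above N g \<Longrightarrow> N \<le> M \<Longrightarrow> fixes_above M g"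
  by (auto simp: fixes_above_def)

lemma fixes_above_tgen_pow:
  assumes "i < n"
  shows "fixes_above (i + 1) (tgen m n i [^]\<^bsub>G\<^esub> (k :: nat))"
proof (induction k)
  case 0
  thus ?case by (simp add: fixes_above_def one_apply)
next
  case (Suc k)
  have "fixes_above (i + 1) (tgen m n i)"
    using assms by (simp add: fixes_above_def tgen_apply)
  with Suc show ?case
    by (simp add: fixes_above_mult)
qed

text \<open>
  The bound on \<open>k\<close> is the one in the definition of the flag major index: below it no power of \<open>t\<^sub>i\<close>
  except the zeroth fixes \<open>i + 1\<close>, so \<open>compatible_tgen_mult\<close> applies \<open>k\<close> times in a row.
\<close>

lemma compatible_tgen_pow_mult:
  assumes i: "i < n" and g: "g \<in> carrier G" and fixed: "fixes_above i g"
    and k: "k < m * (i + 1)"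
  shows "\<exists>h. mono_deg h = k \<and>
    compatible (tgen m n i [^]\<^bsub>G\<^esub> k \<otimes>\<^bsub>G\<^esub> g) = (+) h ` compatible g"
  using k
proof (induction k)
  case 0
  have "(+) 0 ` compatible g = compatible g"
    by (simp add: image_def)
  thus ?case
    using g by (intro exI[of _ 0]) simp
next
  case (Suc k)
  let ?t = "tgen m n i"
  have t: "?t \<in> carrier G"
    using i by (rule tgen_closed)
  obtain h where h: "mono_deg h = k"
    "compatible (?t [^]\<^bsub>G\<^esub> k \<otimes>\<^bsub>G\<^esub> g) = (+) h ` compatible g"
    using Suc.IH Suc.prems by (auto simp del: mult_Suc_right)
  have eq: "?t [^]\<^bsub>G\<^esub> Suc k \<otimes>\<^bsub>G\<^esub> g = ?t \<otimes>\<^bsub>G\<^esub> (?t [^]\<^bsub>G\<^esub> k \<otimes>\<^bsub>G\<^esub> g)"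
    using t g by (simp only: nat_pow_Suc2 m_assoc nat_pow_closed)
  have i': "i + 1 \<in> {1..n}"
    using i by simp
  have "g (i + 1) = of_nat (i + 1)"
    using fixed i' unfolding fixes_above_def by simp
  hence "(?t [^]\<^bsub>G\<^esub> Suc k \<otimes>\<^bsub>G\<^esub> g) (i + 1) = (?t [^]\<^bsub>G\<^esub> Suc k) (i + 1)"
    using i' by (simp add: mult_apply phase_of_nat del: of_nat_Suc of_nat_add nat_pow_Suc)
  also have "\<dots> = omega m ^ (Suc k div (i + 1)) * of_nat (i + 1 - Suc k mod (i + 1))"
    by (rule tgen_pow_apply[OF i])
  also have "\<dots> \<noteq> of_nat (i + 1)"
  proof
    assume eq1: "omega m ^ (Suc k div (i + 1)) * of_nat (i + 1 - Suc k mod (i + 1))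
      = (of_nat (i + 1) :: complex)"
    hence "cmod (omega m ^ (Suc k div (i + 1)) * of_nat (i + 1 - Suc k mod (i + 1)))
      = cmod (of_nat (i + 1))"
      by (rule arg_cong)
    hence "i + 1 - Suc k mod (i + 1) = i + 1"
      by (simp only: norm_mult norm_power norm_omega norm_of_nat power_one mult_1_left of_nat_eq_iff)
    hence 0: "Suc k mod (i + 1) = 0"
      by linarith
    with eq1 have "omega m ^ (Suc k div (i + 1)) * of_nat (i + 1) = 1 * (of_nat (i + 1) :: complex)"
      by (simp del: of_nat_Suc of_nat_add)
    hence 1: "omega m ^ (Suc k div (i + 1)) = 1"
      by (simp only: mult_cancel_right of_nat_eq_0_iff) simp
    have "Suc k div (i + 1) < m"
      using Suc.prems by (simp only: div_less_iff_less_mult)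
    with 1 have "Suc k div (i + 1) = 0"
      using omega_power_eq_1_iff[OF m_pos] by blast
    with 0 show False
      using div_mult_mod_eq[of "Suc k" "i + 1"] by simp
  qed
  finally have moved: "(?t \<otimes>\<^bsub>G\<^esub> (?t [^]\<^bsub>G\<^esub> k \<otimes>\<^bsub>G\<^esub> g)) (i + 1) \<noteq> of_nat (i + 1)"
    unfolding eq .
  have "fixes_above (i + 1) (?t [^]\<^bsub>G\<^esub> k \<otimes>\<^bsub>G\<^esub> g)"
    using fixes_above_mult[OF fixes_above_tgen_pow[OF i] fixes_above_mono[OF fixed]] by simp
  from compatible_tgen_mult[OF i _ this moved] t g
  obtain p where p: "compatible (?t \<otimes>\<^bsub>G\<^esub> (?t [^]\<^bsub>G\<^esub> k \<otimes>\<^bsub>G\<^esub> g)) =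
      (+) (Poly_Mapping.single p 1) ` compatible (?t [^]\<^bsub>G\<^esub> k \<otimes>\<^bsub>G\<^esub> g)"
    by auto
  show ?case
    unfolding eq p h(2) image_image
    using h(1)
    by (intro exI[of _ "Poly_Mapping.single p 1 + h"]) (auto simp: mono_deg_add add.assoc)
qed

text \<open>
  Initial segments of the representation, for induction on the number of factors: \<open>word k n\<close>
  is \<open>tword m n k\<close>.
\<close>

definition word :: "(nat \<Rightarrow> nat) \<Rightarrow> nat \<Rightarrow> (nat \<Rightarrow> complex)" where
  "word k N = foldr (\<lambda>i g. (tgen m n i [^]\<^bsub>G\<^esub> k i) \<otimes>\<^bsub>G\<^esub> g) (rev [0..<N]) \<one>\<^bsub>G\<^esub>"

lemma word_0 [simp]: "word k 0 = \<one>\<^bsub>G\<^esub>"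
  by (simp add: word_def)

lemma word_Suc [simp]: "word k (Suc N) = tgen m n N [^]\<^bsub>G\<^esub> k N \<otimes>\<^bsub>G\<^esub> word k N"
  by (simp add: word_def)

lemma word_cong: "(\<And>i. i < N \<Longrightarrow> k i = k' i) \<Longrightarrow> word k N = word k' N"
  by (induction N) auto

lemma word_closed: "N \<le> n \<Longrightarrow> word k N \<in> carrier G"
  by (induction N) (auto simp: tgen_closed)

lemma fixes_above_word: "N \<le> n \<Longrightarrow> fixes_above N (word k N)"
proof (induction N)
  case 0
  thus ?case by (simp add: fixes_above_def one_apply)
next
  case (Suc N)
  thus ?case
    using fixes_above_tgen_pow[of N "k N"] fixes_above_mono[of N "word k N" "Suc N"]
    by (simp add: fixes_above_mult)
qed

lemma compatible_word:
  assumes "N \<le> n" "\<And>i. i < N \<Longrightarrow> k i < m * (i + 1)"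
  shows "\<exists>h. mono_deg h = (\<Sum>i<N. k i) \<and>
    compatible (word k N) = (+) h ` compatible \<one>\<^bsub>G\<^esub>"
  using assms
proof (induction N)
  case 0
  have "(+) 0 ` compatible \<one>\<^bsub>G\<^esub> = compatible \<one>\<^bsub>G\<^esub>"
    by (simp add: image_def)
  thus ?case
    by (intro exI[of _ 0]) simp
next
  case (Suc N)
  obtain h where h: "mono_deg h = (\<Sum>i<N. k i)"
    "compatible (word k N) = (+) h ` compatible \<one>\<^bsub>G\<^esub>"
    using Suc.IH Suc.prems by auto
  obtain h' where h': "mono_deg h' = k N"
    "compatible (word k (Suc N)) = (+) h' ` compatible (word k N)"
    using compatible_tgen_pow_mult[of N "word k N" "k N"] Suc.prems word_closed[of N k]
      fixes_above_word[of N k] by (auto simp del: mult_Suc_right)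
  show ?case
    unfolding h'(2) h(2) image_image
    using h(1) h'(1)
    by (intro exI[of _ "h' + h"]) (auto simp: mono_deg_add add.assoc)
qed

text \<open>
  By \<open>tgen_pow_apply\<close>, the value at \<open>N\<close> determines the exponent of \<open>t\<^bsub>N - 1\<^esub>\<close>, since the remaining
  factors fix \<open>N\<close>; that power can then be cancelled.
\<close>

lemma word_inj:
  assumes "N \<le> n" "word k N = word k' N"
    and "\<And>i. i < N \<Longrightarrow> k i < m * (i + 1)" "\<And>i. i < N \<Longrightarrow> k' i < m * (i + 1)"
    and "i < N"
  shows "k i = k' i"
  using assms
proof (induction N)
  case (Suc N)
  let ?t = "tgen m n N"
  have N: "N < n" and N1: "N + 1 \<in> {1..n}"
    using Suc.prems(1) by auto
  have apply_last: "word c (Suc N) (N + 1) = omega m ^ (c N div (N + 1)) * of_nat (N + 1 - c N mod (N + 1))"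
    for c
  proof -
    have "word c N (N + 1) = of_nat (N + 1)"
      using fixes_above_word[of N c] Suc.prems(1) N1 by (simp add: fixes_above_def)
    hence "word c (Suc N) (N + 1) = (?t [^]\<^bsub>G\<^esub> c N) (N + 1)"
      using N1 by (simp add: mult_apply phase_of_nat del: of_nat_Suc of_nat_add)
    thus ?thesis
      by (simp only: tgen_pow_apply[OF N])
  qed
  have bounds: "k N < m * (N + 1)" "k' N < m * (N + 1)"
    using Suc.prems(3,4)[of N] by auto
  have eq: "omega m ^ (k N div (N + 1)) * of_nat (N + 1 - k N mod (N + 1)) =
      omega m ^ (k' N div (N + 1)) * (of_nat (N + 1 - k' N mod (N + 1)) :: complex)"
    using Suc.prems(2) by (simp only: flip: apply_last)
  hence "cmod (omega m ^ (k N div (N + 1)) * of_nat (N + 1 - k N mod (N + 1))) =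
      cmod (omega m ^ (k' N div (N + 1)) * of_nat (N + 1 - k' N mod (N + 1)))"
    by (rule arg_cong)
  hence md: "N + 1 - k N mod (N + 1) = N + 1 - k' N mod (N + 1)"
    by (simp only: norm_mult norm_power norm_omega norm_of_nat power_one mult_1_left of_nat_eq_iff)
  have mod_less: "k N mod (N + 1) < N + 1" "k' N mod (N + 1) < N + 1"
    by simp_all
  with md have modeq: "k N mod (N + 1) = k' N mod (N + 1)"
    by linarith
  have "N + 1 - k' N mod (N + 1) \<noteq> 0"
    using mod_less(2) by linarith
  with eq have pow: "omega m ^ (k N div (N + 1)) = omega m ^ (k' N div (N + 1))"
    unfolding md by (simp only: mult_cancel_right of_nat_eq_0_iff) simp
  have "k N div (N + 1) < m" "k' N div (N + 1) < m"
    using bounds by (simp_all only: div_less_iff_less_mult)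
  from omega_power_inj[OF m_pos this pow] modeq have kN: "k N = k' N"
    by (metis div_mult_mod_eq)
  have "word k N = word k' N"
    using Suc.prems(2) kN word_closed[of N] Suc.prems(1) tgen_closed[OF N] by simp
  with Suc.IH Suc.prems kN show ?case
    by (cases "i = N") auto
qed simp

text \<open>
  The last moved value \<open>g(N) = \<omega>\<^bsup>c\<^esup> v\<close> is attained by a power of \<open>t\<^bsub>N - 1\<^esub>\<close>; dividing by that power
  gives an element that fixes \<open>N\<close> as well.
\<close>

lemma ex_word:
  assumes "N \<le> n" "g \<in> carrier G" "fixes_above N g"
  shows "\<exists>k. (\<forall>i<N. k i < m * (i + 1)) \<and> word k N = g"
  using assms
proof (induction N arbitrary: g)
  case 0
  have "g = \<one>\<^bsub>G\<^esub>"
  proof (rule wreath_eqI)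
    fix j assume "j \<in> {1..n}"
    moreover from this have "g j = of_nat j"
      using 0(3) by (simp add: fixes_above_def)
    ultimately show "nmod (g j) = nmod (\<one>\<^bsub>G\<^esub> j)" "phase (g j) = phase (\<one>\<^bsub>G\<^esub> j)"
      by (simp_all add: one_apply)
  qed (use 0 in auto)
  thus ?case by auto
next
  case (Suc N)
  let ?t = "tgen m n N"
  have N: "N < n" and N1: "N + 1 \<in> {1..n}"
    using Suc.prems(1) by auto
  have t: "?t \<in> carrier G"
    using N by (rule tgen_closed)
  obtain a where "phase (g (N + 1)) = omega m ^ a"
    using phase_is_power[OF Suc.prems(2) N1] by blast
  also have "omega m ^ a = omega m ^ (m * (a div m) + a mod m)"
    by simp
  also have "\<dots> = omega m ^ (a mod m)"
    using omega_power_m[of m] m_pos by (simp only: power_add power_mult) simp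
  finally have c: "phase (g (N + 1)) = omega m ^ (a mod m)" .
  define v where "v = nmod (g (N + 1))"
  have v: "v \<ge> 1" "v \<le> N + 1"
    using nmod_in[OF Suc.prems(2) N1] fixes_above_nmod[OF Suc.prems(2,3) N1] by (auto simp: v_def)
  define r where "r = N + 1 - v"
  \<comment> \<open>Chosen so that \<open>tgen_pow_apply\<close> gives \<open>\<omega>\<^bsup>a mod m\<^esup> v\<close> at \<open>N + 1\<close>.\<close>
  define kN where "kN = a mod m * (N + 1) + r"
  have r: "r < N + 1"
    using v by (simp add: r_def)
  have "a mod m < m"
    using m_pos by simp
  hence kN: "kN < m * (N + 1)"
  proof -
    have "kN < (a mod m + 1) * (N + 1)"
      using r by (simp add: kN_def)
    also have "\<dots> \<le> m * (N + 1)"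
      using \<open>a mod m < m\<close> by (intro mult_right_mono) auto
    finally show ?thesis .
  qed
  have "(?t [^]\<^bsub>G\<^esub> kN) (N + 1) = omega m ^ (a mod m) * of_nat v"
  proof -
    have "kN div (N + 1) = a mod m" "kN mod (N + 1) = r"
      using r by (simp_all add: kN_def del: mult_Suc_right)
    moreover have "N + 1 - r = v"
      using v by (simp add: r_def)
    ultimately show ?thesis
      by (simp only: tgen_pow_apply[OF N])
  qed
  hence top: "(?t [^]\<^bsub>G\<^esub> kN) (N + 1) = g (N + 1)"
    using phase_nmod[OF Suc.prems(2) N1] by (simp only: c v_def)
  define h where "h = inv\<^bsub>G\<^esub> (?t [^]\<^bsub>G\<^esub> kN) \<otimes>\<^bsub>G\<^esub> g"
  have h: "h \<in> carrier G"
    using t Suc.prems(2) by (simp add: h_def)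
  have g_eq: "?t [^]\<^bsub>G\<^esub> kN \<otimes>\<^bsub>G\<^esub> h = g"
    using t Suc.prems(2) by (simp add: h_def flip: m_assoc)
  have fixed_if: "h q = of_nat q" if q: "q \<in> {1..n}" "(?t [^]\<^bsub>G\<^esub> kN) q = g q" for q
  proof -
    let ?s = "?t [^]\<^bsub>G\<^esub> kN"
    have s: "?s \<in> carrier G"
      using t by simp
    have "nmod (?s (nmod (h q))) = nmod (?s q)"
      using nmod_mult[OF s h q(1)] g_eq q(2) by simp
    hence 1: "nmod (h q) = q"
      using nmod_inj[OF s nmod_in[OF h q(1)] q(1)] by blast
    have "phase (h q) * phase (?s q) = phase (?s q)"
      using phase_mult_G[OF s h q(1)] g_eq q(2) 1 by simp
    hence "phase (h q) = 1"
      using phase_nonzero[OF s q(1)] by simp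
    thus ?thesis
      using phase_nmod[OF h q(1)] 1 by simp
  qed
  have "fixes_above N h"
    unfolding fixes_above_def
  proof (intro ballI impI)
    fix q assume q: "q \<in> {1..n}" "N < q"
    have "(?t [^]\<^bsub>G\<^esub> kN) q = g q"
    proof (cases "q = N + 1")
      case False
      thus ?thesis
        using q fixes_above_tgen_pow[OF N, of kN] Suc.prems(3) by (simp add: fixes_above_def)
    qed (use top in simp)
    thus "h q = of_nat q"
      using fixed_if q by blast
  qed
  then obtain k where k: "\<forall>i<N. k i < m * (i + 1)" "word k N = h"
    using Suc.IH[OF _ h] Suc.prems(1) by auto
  have "word (k(N := kN)) (Suc N) = g"
    using k(2) g_eq word_cong[of N "k(N := kN)" k] by simp
  moreover have "\<forall>i<Suc N. (k(N := kN)) i < m * (i + 1)"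
    using k(1) kN by (auto simp: less_Suc_eq)
  ultimately show ?case
    by blast
qed

theorem compatible_flag_major:
  assumes "g \<in> carrier G"
  shows "\<exists>h. mono_deg h = flag_major m n g \<and>
    compatible g = (+) h ` compatible \<one>\<^bsub>G\<^esub>"
proof -
  let ?B = "\<Pi>\<^sub>E i\<in>{..<n}. {..<m * (i + 1)}"
  have tword: "tword m n k = word k n" for k
    by (simp add: tword_def word_def)
  obtain k where k: "\<forall>i<n. k i < m * (i + 1)" "word k n = g"
    using ex_word[of n g] assms by (auto simp: fixes_above_def)
  define k' where "k' = restrict k {..<n}"
  have k': "k' \<in> ?B" "word k' n = g"
    using k word_cong[of n k' k] by (auto simp: k'_def)
  have "(THE c. c \<in> ?B \<and> tword m n c = g) = k'"
  proof (rule the_equality)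
    fix c assume c: "c \<in> ?B \<and> tword m n c = g"
    show "c = k'"
    proof (rule extensionalityI[of _ "{..<n}"])
      show "c i = k' i" if "i \<in> {..<n}" for i
        using word_inj[of n c k' i] c k' that by (auto simp: tword PiE_iff)
    qed (use c k' in \<open>auto simp: PiE_iff\<close>)
  qed (use k' in \<open>simp add: tword\<close>)
  hence "flag_major m n g = (\<Sum>i<n. k' i)"
    by (simp add: flag_major_def)
  thus ?thesis
    using compatible_word[of n k'] k' by (auto simp: PiE_iff)
qed

end

section \<open>Factorizations in the group and sorted tuples\<close>

text \<open>
  A strict total order on a finite set is the pullback of the order of \<open>{1..card A}\<close> along the rank.
  Together with \<open>bij_betw_eq_rank\<close> this yields existence and uniqueness of sorting permutations.
\<close>

lemma ex_rank:
  assumes "finite A"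
    and irrefl: "\<And>i. i \<in> A \<Longrightarrow> \<not> R i i"
    and trans: "\<And>i j k. i \<in> A \<Longrightarrow> j \<in> A \<Longrightarrow> k \<in> A \<Longrightarrow> R i j \<Longrightarrow> R j k \<Longrightarrow> R i k"
    and total: "\<And>i j. i \<in> A \<Longrightarrow> j \<in> A \<Longrightarrow> i \<noteq> j \<Longrightarrow> R i j \<or> R j i"
  obtains s :: "'a \<Rightarrow> nat" where "bij_betw s A {1..card A}"
    "\<And>i j. i \<in> A \<Longrightarrow> j \<in> A \<Longrightarrow> s i < s j \<longleftrightarrow> R i j"
proof -
  define s where "s j = card {i \<in> A. R i j \<or> i = j}" for j
  have mono: "s i < s j" if "i \<in> A" "j \<in> A" "R i j" for i j
    unfolding s_def
  proof (rule psubset_card_mono)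
    have "j \<notin> {k \<in> A. R k i \<or> k = i}"
      using that irrefl trans by blast
    moreover have "{k \<in> A. R k i \<or> k = i} \<subseteq> {k \<in> A. R k j \<or> k = j}"
      using that trans by blast
    ultimately show "{k \<in> A. R k i \<or> k = i} \<subset> {k \<in> A. R k j \<or> k = j}"
      using that by blast
  qed (use assms(1) in simp)
  have iff: "s i < s j \<longleftrightarrow> R i j" if "i \<in> A" "j \<in> A" for i j
    using mono[OF that] mono[OF that(2,1)] total[OF that] by (cases "i = j") auto
  have inj: "inj_on s A"
    using mono total by (metis inj_onI less_irrefl)
  have "s ` A \<subseteq> {1..card A}"
  proof safe
    fix j assume "j \<in> A"
    hence "card {j} \<le> s j" "s j \<le> card A"
      unfolding s_def using assms(1) by (intro card_mono; auto)+
    thus "s j \<in> {1..card A}" by simp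
  qed
  hence "s ` A = {1..card A}"
    using inj by (intro card_subset_eq) (auto simp: card_image)
  thus ?thesis
    using that iff inj by (simp add: bij_betw_def)
qed

lemma bij_betw_eq_rank:
  assumes "bij_betw s A {1..N :: nat}" "j \<in> A"
  shows "s j = card {i \<in> A. s i \<le> s j}"
proof -
  have "bij_betw s {i \<in> A. s i \<le> s j} {1..s j}"
    unfolding bij_betw_def
  proof
    show "inj_on s {i \<in> A. s i \<le> s j}"
      using assms(1) by (auto simp: bij_betw_def inj_on_def)
    have img: "s ` A = {1..N}"
      using assms(1) by (simp add: bij_betw_def)
    show "s ` {i \<in> A. s i \<le> s j} = {1..s j}"
    proof
      show "s ` {i \<in> A. s i \<le> s j} \<subseteq> {1..s j}"
        using img by auto
      show "{1..s j} \<subseteq> s ` {i \<in> A. s i \<le> s j}"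
      proof
        fix k assume k: "k \<in> {1..s j}"
        moreover have "s j \<in> {1..N}"
          using img assms(2) by blast
        ultimately have "k \<in> s ` A"
          unfolding img by simp
        thus "k \<in> s ` {i \<in> A. s i \<le> s j}"
          using k by auto
      qed
    qed
  qed
  hence "card {i \<in> A. s i \<le> s j} = card {1..s j}"
    by (rule bij_betw_same_card)
  thus ?thesis by simp
qed

lemma append_less_append_same_length:
  fixes xs ys :: "'a :: linorder list"
  assumes "length xs = length ys"
  shows "xs @ [x] < ys @ [y] \<longleftrightarrow> xs < ys \<or> (xs = ys \<and> x < y)"
  using assms by (induction xs ys rule: list_induct2) auto

text \<open>
  The column of position \<open>j\<close>. The last sequence of the tuple is the most significant one in
  lexicographic comparisons, hence the reversal: prepending a sequence to the tuple only refines the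
  comparison.
\<close>

definition col :: "(nat \<Rightarrow>\<^sub>0 nat) list \<Rightarrow> nat \<Rightarrow> nat list" where
  "col as j = rev (map (\<lambda>a. lookup a j) as)"

lemma col_Cons: "col (a # as) j = col as j @ [lookup a j]"
  by (simp add: col_def)

lemma length_col [simp]: "length (col as j) = length as"
  by (simp add: col_def)

context cyclic_wreath
begin

definition monomials :: "(nat \<Rightarrow>\<^sub>0 nat) set" where
  "monomials = {a. keys a \<subseteq> {1..n}}"

lemma monomials_eqI:
  assumes "a \<in> monomials" "b \<in> monomials" "\<And>j. j \<in> {1..n} \<Longrightarrow> lookup a j = lookup b j"
  shows "a = b"
proof (rule poly_mapping_eqI)
  fix j
  show "lookup a j = lookup b j"
  proof (cases "j \<in> {1..n}")
    case False
    hence "j \<notin> keys a" "j \<notin> keys b"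
      using assms(1,2) by (auto simp: monomials_def)
    thus ?thesis by (simp add: in_keys_iff)
  qed (rule assms(3))
qed

lemma mono_deg_monomials: "a \<in> monomials \<Longrightarrow> mono_deg a = (\<Sum>j=1..n. lookup a j)"
  by (rule mono_deg_superset) (auto simp: monomials_def)

text \<open>
  This is the right action by rearrangement, \<open>a \<mapsto> a \<circ> |g|\<close>, cut off outside of \<open>{1..n}\<close>.
\<close>

definition act :: "(nat \<Rightarrow> complex) \<Rightarrow> (nat \<Rightarrow>\<^sub>0 nat) \<Rightarrow> (nat \<Rightarrow>\<^sub>0 nat)" where
  "act g a = Abs_poly_mapping (\<lambda>j. if j \<in> {1..n} then lookup a (nmod (g j)) else 0)"

lemma lookup_act: "lookup (act g a) j = (if j \<in> {1..n} then lookup a (nmod (g j)) else 0)"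
proof -
  have "finite {j. (if j \<in> {1..n} then lookup a (nmod (g j)) else 0) \<noteq> 0}"
    by (rule finite_subset[of _ "{1..n}"]) auto
  thus ?thesis
    by (simp add: act_def Abs_poly_mapping_inverse)
qed

lemma act_monomials [simp]: "act g a \<in> monomials"
  by (auto simp: monomials_def in_keys_iff lookup_act split: if_splits)

lemma act_act: "g \<in> carrier G \<Longrightarrow> h \<in> carrier G \<Longrightarrow> act h (act g a) = act (g \<otimes>\<^bsub>G\<^esub> h) a"
  by (rule monomials_eqI) (use nmod_in in \<open>auto simp: lookup_act nmod_mult simp del: atLeastAtMost_iff\<close>)

lemma act_one: "a \<in> monomials \<Longrightarrow> act \<one>\<^bsub>G\<^esub> a = a"
  by (rule monomials_eqI) (auto simp: lookup_act)

lemma act_inv: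
  assumes "g \<in> carrier G" "a \<in> monomials"
  shows "act g (act (inv\<^bsub>G\<^esub> g) a) = a" "act (inv\<^bsub>G\<^esub> g) (act g a) = a"
  using assms by (simp_all add: act_act act_one)

lemma act_inj: "g \<in> carrier G \<Longrightarrow> a \<in> monomials \<Longrightarrow> b \<in> monomials \<Longrightarrow> act g a = act g b \<longleftrightarrow> a = b"
  by (metis act_inv(2))

lemma mono_deg_act:
  assumes "g \<in> carrier G" "a \<in> monomials"
  shows "mono_deg (act g a) = mono_deg a"
proof -
  have "mono_deg (act g a) = (\<Sum>j=1..n. lookup a (nmod (g j)))"
    by (simp add: mono_deg_monomials lookup_act)
  also have "\<dots> = (\<Sum>j=1..n. lookup a j)"
    by (rule sum.reindex_bij_betw[OF bij_nmod[OF assms(1)]])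
  also have "\<dots> = mono_deg a"
    using assms(2) by (simp add: mono_deg_monomials)
  finally show ?thesis .
qed

text \<open>
  One round of sorting: \<open>|h|\<close> ranks the positions by decreasing entries of \<open>a\<close>, with ties broken by
  \<open>|g|\<close>, and the phases of \<open>h\<close> are those of \<open>g\<close> with the contribution of \<open>a\<close> divided out. The
  factor that this round splits off is \<open>g h\<^bsup>-1\<^esup>\<close>.
\<close>

definition refines :: "(nat \<Rightarrow> complex) \<Rightarrow> (nat \<Rightarrow>\<^sub>0 nat) \<Rightarrow> (nat \<Rightarrow> complex) \<Rightarrow> bool" where
  "refines g a h \<longleftrightarrow>
     (\<forall>j\<in>{1..n}. phase (g j) = phase (h j) * omega m ^ lookup a j) \<and>
     (\<forall>i\<in>{1..n}. \<forall>j\<in>{1..n}. nmod (h i) < nmod (h j) \<longleftrightarrow>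
        lookup a i > lookup a j \<or> (lookup a i = lookup a j \<and> nmod (g i) < nmod (g j)))"

lemma ex_refines:
  assumes g: "g \<in> carrier G"
  obtains h where "h \<in> carrier G" "refines g a h"
proof -
  define R where "R i j \<longleftrightarrow> lookup a i > lookup a j \<or>
    (lookup a i = lookup a j \<and> nmod (g i) < nmod (g j))" for i j
  obtain s where s: "bij_betw s {1..n} {1..card {1..n}}"
    "\<And>i j. i \<in> {1..n} \<Longrightarrow> j \<in> {1..n} \<Longrightarrow> s i < s j \<longleftrightarrow> R i j"
  proof (rule ex_rank[of "{1..n}" R])
    fix i j assume "i \<in> {1..n}" "j \<in> {1..n}" "i \<noteq> j"
    thus "R i j \<or> R j i"
      using nmod_inj[OF g, of i j] by (auto simp: R_def)
  qed (auto simp: R_def)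
  obtain b where b: "\<forall>j\<in>{1..n}. phase (g j) = omega m ^ b j"
    using bchoice[of "{1..n}" "\<lambda>j a. phase (g j) = omega m ^ a"] phase_is_power[OF g] by blast
  \<comment> \<open>\<open>\<omega>\<^bsup>(m - 1) e\<^esup>\<close> is the inverse of \<open>\<omega>\<^bsup>e\<^esup>\<close>.\<close>
  have inv: "omega m ^ ((m - 1) * e) * omega m ^ e = 1" for e
  proof -
    have "(m - 1) * e + e = m * e"
      using m_pos by (cases m) auto
    hence "omega m ^ ((m - 1) * e) * omega m ^ e = omega m ^ (m * e)"
      by (simp only: power_add [symmetric])
    thus ?thesis
      using omega_power_m[of m] m_pos by (simp add: power_mult)
  qed
  have "bij_betw s {1..n} {1..n}"
    using s(1) by simp
  then obtain h where h: "h \<in> carrier G"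
    "\<And>j. j \<in> {1..n} \<Longrightarrow> nmod (h j) = s j"
    "\<And>j. j \<in> {1..n} \<Longrightarrow> phase (h j) = omega m ^ (b j + (m - 1) * lookup a j)"
    by (rule ex_wreath[where c = "\<lambda>j. b j + (m - 1) * lookup a j"]) blast
  have "refines g a h"
    unfolding refines_def
    using h(2,3) s(2) b inv by (auto simp: R_def power_add mult.assoc simp del: atLeastAtMost_iff)
  thus ?thesis
    using that h(1) by blast
qed

lemma refines_unique:
  assumes h: "h \<in> carrier G" and h': "h' \<in> carrier G" and r: "refines g a h" and r': "refines g a h'"
  shows "h = h'"
proof (rule wreath_eqI[OF h h'])
  fix j assume j: "j \<in> {1..n}"
  have "nmod (h j) < nmod (h i) \<longleftrightarrow> nmod (h' j) < nmod (h' i)" if "i \<in> {1..n}" for i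
    using r r' j that unfolding refines_def by blast
  hence "{i \<in> {1..n}. nmod (h i) \<le> nmod (h j)} = {i \<in> {1..n}. nmod (h' i) \<le> nmod (h' j)}"
    by (auto simp: not_less [symmetric])
  thus "nmod (h j) = nmod (h' j)"
    using bij_betw_eq_rank[OF bij_nmod[OF h] j] bij_betw_eq_rank[OF bij_nmod[OF h'] j] by simp
  have "phase (h j) * omega m ^ lookup a j = phase (h' j) * omega m ^ lookup a j"
    using r r' j unfolding refines_def by metis
  thus "phase (h j) = phase (h' j)"
    using omega_nonzero by simp
qed

lemma compatible_monomials: "l \<in> compatible g \<Longrightarrow> l \<in> monomials"
  by (simp add: compatible_def monomials_def)

text \<open>
  Compatibility is sorting seen from the sorted side. Replacing the positions \<open>p = |h(j)|\<close> by \<open>j\<close>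
  turns the phases of \<open>g\<close> into quotients of those of \<open>gh\<close> and \<open>h\<close>, and the condition on \<open>p < q\<close> into
  one direction of the ranking condition; the other direction is automatic since both sides are
  strict total orders.
\<close>

lemma compatible_iff_refines:
  assumes g: "g \<in> carrier G" and h: "h \<in> carrier G" and l: "l \<in> monomials"
  shows "l \<in> compatible g \<longleftrightarrow> refines (g \<otimes>\<^bsub>G\<^esub> h) (act h l) h"
proof
  assume c: "l \<in> compatible g"
  let ?R = "\<lambda>i j. lookup l (nmod (h i)) > lookup l (nmod (h j)) \<or>
    (lookup l (nmod (h i)) = lookup l (nmod (h j)) \<and> nmod (g (nmod (h i))) < nmod (g (nmod (h j))))"
  have imp: "?R i j" if "i \<in> {1..n}" "j \<in> {1..n}" "nmod (h i) < nmod (h j)" for i j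
    using c nmod_in[OF h that(1)] nmod_in[OF h that(2)] that(3) unfolding compatible_def by blast
  have "nmod (h i) < nmod (h j) \<longleftrightarrow> ?R i j" if ij: "i \<in> {1..n}" "j \<in> {1..n}" for i j
    using imp[OF ij] imp[OF ij(2,1)] by (cases "nmod (h i)" "nmod (h j)" rule: linorder_cases) auto
  thus "refines (g \<otimes>\<^bsub>G\<^esub> h) (act h l) h"
    using c g h nmod_in[OF h]
    by (auto simp: refines_def lookup_act nmod_mult phase_mult_G compatible_def
        simp del: atLeastAtMost_iff)
next
  assume r: "refines (g \<otimes>\<^bsub>G\<^esub> h) (act h l) h"
  have "phase (g p) = omega m ^ lookup l p" if p: "p \<in> {1..n}" for p
  proof -
    obtain j where j: "j \<in> {1..n}" "nmod (h j) = p"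
      using nmod_surj[OF h p] by blast
    have "phase (h j) * phase (g p) = phase (h j) * omega m ^ lookup l p"
      using r j g h by (auto simp: refines_def lookup_act phase_mult_G simp del: atLeastAtMost_iff)
    thus ?thesis
      using phase_nonzero[OF h j(1)] by simp
  qed
  moreover have "lookup l p > lookup l q \<or> (lookup l p = lookup l q \<and> nmod (g p) < nmod (g q))"
    if p: "p \<in> {1..n}" and q: "q \<in> {1..n}" and less: "p < q" for p q
  proof -
    obtain i j where ij: "i \<in> {1..n}" "nmod (h i) = p" "j \<in> {1..n}" "nmod (h j) = q"
      using nmod_surj[OF h p] nmod_surj[OF h q] by metis
    show ?thesis
      using r ij less g h by (auto simp: refines_def lookup_act nmod_mult simp del: atLeastAtMost_iff)
  qed
  ultimately show "l \<in> compatible g"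
    using l by (simp add: compatible_def monomials_def)
qed

text \<open>
  For \<open>g = 1\<close> these are the tuples with lexicographically decreasing columns and column sums divisible
  by \<open>m\<close>. General \<open>g\<close> is needed for the induction: prescribing the phases and breaking ties by \<open>|g|\<close>
  is what remains to be demanded of a tuple after some of its sequences have been split off.
\<close>

definition sorted_tuples :: "(nat \<Rightarrow> complex) \<Rightarrow> nat \<Rightarrow> (nat \<Rightarrow>\<^sub>0 nat) list set" where
  "sorted_tuples g t = {as. length as = t \<and> set as \<subseteq> monomials \<and>
     (\<forall>j\<in>{1..n}. phase (g j) = (\<Prod>a\<leftarrow>as. omega m ^ lookup a j)) \<and>
     (\<forall>i\<in>{1..n}. \<forall>j\<in>{1..n}. i < j \<longrightarrow>
        col as i > col as j \<or> (col as i = col as j \<and> nmod (g i) < nmod (g j)))}"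

lemma sorted_tuples_Nil:
  assumes "g \<in> carrier G"
  shows "[] \<in> sorted_tuples g 0 \<longleftrightarrow> g = \<one>\<^bsub>G\<^esub>"
proof
  assume s: "[] \<in> sorted_tuples g 0"
  show "g = \<one>\<^bsub>G\<^esub>"
  proof (rule wreath_eqI)
    fix j assume j: "j \<in> {1..n}"
    show "phase (g j) = phase (\<one>\<^bsub>G\<^esub> j)"
      using s j by (simp add: sorted_tuples_def)
    have mono: "i < k \<Longrightarrow> nmod (g i) < nmod (g k)" if "i \<in> {1..n}" "k \<in> {1..n}" for i k
      using s that by (simp add: sorted_tuples_def col_def)
    have iff: "nmod (g i) \<le> nmod (g j) \<longleftrightarrow> i \<le> j" if "i \<in> {1..n}" for i
      using mono[OF that j] mono[OF j that] by (cases i j rule: linorder_cases) auto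
    have "{i \<in> {1..n}. nmod (g i) \<le> nmod (g j)} = {i \<in> {1..n}. i \<le> j}"
      using iff by blast
    also have "\<dots> = {1..j}"
      using j by auto
    finally show "nmod (g j) = nmod (\<one>\<^bsub>G\<^esub> j)"
      using bij_betw_eq_rank[OF bij_nmod[OF assms] j] j by simp
  qed (use assms in auto)
qed (simp add: sorted_tuples_def col_def)

text \<open>
  The first sequence of the tuple is the least significant one, so comparing columns with ties broken by
  \<open>|g|\<close> means comparing the columns of the rest with ties broken first by \<open>a\<close>, then by \<open>|g|\<close>,
  which is the order of \<open>|h|\<close>.
\<close>

lemma sorted_tuples_Cons:
  assumes "refines g a h"
  shows "a # as \<in> sorted_tuples g (Suc t) \<longleftrightarrow> a \<in> monomials \<and> as \<in> sorted_tuples h t"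
proof -
  have "phase (g j) = (\<Prod>b\<leftarrow>a # as. omega m ^ lookup b j) \<longleftrightarrow>
      phase (h j) = (\<Prod>b\<leftarrow>as. omega m ^ lookup b j)" if "j \<in> {1..n}" for j
    using assms that omega_nonzero by (simp add: refines_def)
  moreover have "(col (a # as) i > col (a # as) j \<or>
        (col (a # as) i = col (a # as) j \<and> nmod (g i) < nmod (g j))) \<longleftrightarrow>
      (col as i > col as j \<or> (col as i = col as j \<and> nmod (h i) < nmod (h j)))"
    if "i \<in> {1..n}" "j \<in> {1..n}" for i j
  proof -
    have "nmod (h i) < nmod (h j) \<longleftrightarrow>
        lookup a i > lookup a j \<or> (lookup a i = lookup a j \<and> nmod (g i) < nmod (g j))"
      using assms that unfolding refines_def by blast
    thus ?thesis
      by (auto simp: col_Cons append_less_append_same_length)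
  qed
  ultimately show ?thesis
    unfolding sorted_tuples_def by (auto simp del: atLeastAtMost_iff)
qed

abbreviation product :: "(nat \<Rightarrow> complex) list \<Rightarrow> (nat \<Rightarrow> complex)" where
  "product gs \<equiv> foldr (\<lambda>g h. g \<otimes>\<^bsub>G\<^esub> h) gs \<one>\<^bsub>G\<^esub>"

lemma product_closed: "set gs \<subseteq> carrier G \<Longrightarrow> product gs \<in> carrier G"
  by (induction gs) auto

text \<open>
  The \<open>i\<close>-th sequence is rearranged by the product of the factors after the \<open>i\<close>-th, which undoes
  the sorting of the rounds up to the \<open>i\<close>-th.
\<close>

fun glue :: "(nat \<Rightarrow> complex) list \<Rightarrow> (nat \<Rightarrow>\<^sub>0 nat) list \<Rightarrow> (nat \<Rightarrow>\<^sub>0 nat) list" where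
  "glue (g # gs) (l # ls) = act (product gs) l # glue gs ls"
| "glue _ _ = []"

definition factored :: "(nat \<Rightarrow> complex) \<Rightarrow> nat \<Rightarrow> ((nat \<Rightarrow> complex) list \<times> (nat \<Rightarrow>\<^sub>0 nat) list) set" where
  "factored g t = {(gs, ls). length gs = t \<and> set gs \<subseteq> carrier G \<and> product gs = g \<and>
     list_all2 (\<lambda>l g. l \<in> compatible g) ls gs}"

lemma map_mono_deg_glue:
  assumes "set gs \<subseteq> carrier G" "list_all2 (\<lambda>l g. l \<in> compatible g) ls gs"
  shows "map mono_deg (glue gs ls) = map mono_deg ls"
  using assms(2,1)
  by (induction rule: list_all2_induct)
     (auto simp: mono_deg_act compatible_monomials product_closed)

text \<open>
  By induction on \<open>t\<close>. For given \<open>g\<close> and first sequence \<open>a\<close>, the element \<open>h\<close> with \<open>refines g a h\<close>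
  exists and is unique; it has to be the product of the remaining factors, so the first factor is
  \<open>g h\<^bsup>-1\<^esup>\<close>, and \<open>compatible_iff_refines\<close> shows that the sorted form of \<open>a\<close> is compatible with it.
  The rest of the tuple is treated by the induction hypothesis for \<open>h\<close>.
\<close>

theorem bij_betw_glue:
  assumes "g \<in> carrier G"
  shows "bij_betw (\<lambda>(gs, ls). glue gs ls) (factored g t) (sorted_tuples g t)"
  using assms
proof (induction t arbitrary: g)
  case 0
  have "factored g 0 = (if g = \<one>\<^bsub>G\<^esub> then {([], [])} else {})"
    by (auto simp: factored_def)
  moreover have "sorted_tuples g 0 = (if g = \<one>\<^bsub>G\<^esub> then {[]} else {})"
    using sorted_tuples_Nil[OF 0] by (auto simp: sorted_tuples_def)
  ultimately show ?case by (simp add: bij_betw_def)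
next
  case (Suc t)
  have head: "refines g (act (product gs) l) (product gs) \<and> product gs \<in> carrier G \<and>
      (gs, ls) \<in> factored (product gs) t \<and> l \<in> monomials \<and> p = g \<otimes>\<^bsub>G\<^esub> inv\<^bsub>G\<^esub> (product gs)"
    if "(p # gs, l # ls) \<in> factored g (Suc t)" for p gs l ls
  proof -
    have *: "p \<in> carrier G" "product gs \<in> carrier G" "l \<in> compatible p" "g = p \<otimes>\<^bsub>G\<^esub> product gs"
      using that product_closed[of gs] by (auto simp: factored_def)
    thus ?thesis
      using that compatible_iff_refines[of p "product gs" l] compatible_monomials[of l p] inv_solve_right
      by (auto simp: factored_def m_assoc)
  qed
  have split: "\<exists>p gs' l ls'. gs = p # gs' \<and> ls = l # ls'" if "(gs, ls) \<in> factored g (Suc t)" for gs ls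
    using that by (cases gs; cases ls) (auto simp: factored_def)
  show ?case
    unfolding bij_betw_def
  proof
    show "inj_on (\<lambda>(gs, ls). glue gs ls) (factored g (Suc t))"
    proof (rule inj_onI, clarify)
      fix gs ls gs' ls'
      assume in1: "(gs, ls) \<in> factored g (Suc t)" and in2: "(gs', ls') \<in> factored g (Suc t)"
        and eq: "glue gs ls = glue gs' ls'"
      obtain p hs l ks p' hs' l' ks' where
        gs: "gs = p # hs" "ls = l # ks" "gs' = p' # hs'" "ls' = l' # ks'"
        using split[OF in1] split[OF in2] by blast
      note h1 = head[OF in1[unfolded gs]] and h2 = head[OF in2[unfolded gs]]
      have acts: "act (product hs) l = act (product hs') l'" and glues: "glue hs ks = glue hs' ks'"
        using eq by (auto simp: gs)
      have prods: "product hs = product hs'"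
        using h1 h2 acts refines_unique by metis
      have "(hs, ks) = (hs', ks')"
        using inj_onD[OF bij_betw_imp_inj_on[OF Suc.IH[of "product hs"]], of "(hs, ks)" "(hs', ks')"]
          h1 h2 glues prods by simp
      moreover have "l = l'"
        using acts prods h1 h2 act_inj by metis
      ultimately show "gs = gs' \<and> ls = ls'"
        using h1 h2 by (simp add: gs)
    qed
    show "(\<lambda>(gs, ls). glue gs ls) ` factored g (Suc t) = sorted_tuples g (Suc t)"
    proof (intro equalityI subsetI)
      fix as assume "as \<in> (\<lambda>(gs, ls). glue gs ls) ` factored g (Suc t)"
      then obtain p gs l ls where in1: "(p # gs, l # ls) \<in> factored g (Suc t)"
        and as: "as = act (product gs) l # glue gs ls"
        using split by fastforce
      note h = head[OF in1]
      have "glue gs ls \<in> sorted_tuples (product gs) t"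
        using bij_betwE[OF Suc.IH[of "product gs"]] h by auto
      thus "as \<in> sorted_tuples g (Suc t)"
        unfolding as using sorted_tuples_Cons h by auto
    next
      fix as assume in2: "as \<in> sorted_tuples g (Suc t)"
      then obtain a bs where as: "as = a # bs"
        by (cases as) (auto simp: sorted_tuples_def)
      obtain h where h: "h \<in> carrier G" "refines g a h"
        using ex_refines[OF Suc.prems] by blast
      have bs: "a \<in> monomials" "bs \<in> sorted_tuples h t"
        using in2 sorted_tuples_Cons[OF h(2)] unfolding as by auto
      obtain gs ls where gs: "(gs, ls) \<in> factored h t" "bs = glue gs ls"
      proof -
        have "bs \<in> (\<lambda>(gs, ls). glue gs ls) ` factored h t"
          using bij_betw_imp_surj_on[OF Suc.IH[OF h(1)]] bs(2) by simp
        thus ?thesis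
          using that by (elim imageE) (auto split: prod.splits)
      qed
      define p where "p = g \<otimes>\<^bsub>G\<^esub> inv\<^bsub>G\<^esub> h"
      define l where "l = act (inv\<^bsub>G\<^esub> h) a"
      have p: "p \<in> carrier G" "p \<otimes>\<^bsub>G\<^esub> h = g"
        using Suc.prems h(1) by (simp_all add: p_def m_assoc)
      have l: "act h l = a" "l \<in> monomials"
        using h(1) bs(1) by (simp_all add: l_def act_inv)
      have "l \<in> compatible p"
        using compatible_iff_refines[OF p(1) h(1) l(2)] h(2) p(2) l(1) by simp
      hence "(p # gs, l # ls) \<in> factored g (Suc t)"
        using gs(1) p by (auto simp: factored_def)
      moreover have "as = glue (p # gs) (l # ls)"
        using gs l(1) by (auto simp: as factored_def)
      ultimately show "as \<in> (\<lambda>(gs, ls). glue gs ls) ` factored g (Suc t)"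
        by force
    qed
  qed
qed

end

section \<open>Dimensions of spaces of invariants\<close>

text \<open>
  The basis consists of the indicators of the fibres of \<open>\<rho>\<close>; \<open>C\<close> picks one point in each fibre.
\<close>

lemma dim_constant_on_fibres:
  fixes T C :: "'a set" and \<rho> :: "'a \<Rightarrow> 'b"
  assumes fin: "finite T" and C: "C \<subseteq> T" and inj: "inj_on \<rho> C"
    and cover: "\<And>a. a \<in> T \<Longrightarrow> \<exists>c\<in>C. \<rho> c = \<rho> a"
  shows "free_dim {p :: 'a \<Rightarrow>\<^sub>0 complex. keys p \<subseteq> T \<and>
    (\<forall>a\<in>T. \<forall>b\<in>T. \<rho> a = \<rho> b \<longrightarrow> lookup p a = lookup p b)} = card C" (is "free_dim ?W = _")
proof -
  define e :: "'a \<Rightarrow> 'a \<Rightarrow>\<^sub>0 complex" where "e c = (\<Sum>a | a \<in> T \<and> \<rho> a = \<rho> c. Poly_Mapping.single a 1)" for c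
  have lookup_e: "lookup (e c) a = (if a \<in> T \<and> \<rho> a = \<rho> c then 1 else 0)" for a c
    using fin by (auto simp: e_def lookup_sum lookup_single when_def)
  have finC: "finite C"
    using C fin by (rule finite_subset)
  have lookup_comb: "lookup (\<Sum>c\<in>C. scale (u c) (e c)) a = (if a \<in> T then u d else 0)"
    if "d \<in> C" "a \<in> T \<Longrightarrow> \<rho> d = \<rho> a" for u a d
  proof -
    have "lookup (\<Sum>c\<in>C. scale (u c) (e c)) a = (\<Sum>c\<in>C. if c = d then (if a \<in> T then u d else 0) else 0)"
      unfolding lookup_sum
      by (rule sum.cong) (use that inj in \<open>auto simp: lookup_e dest: inj_onD\<close>)
    thus ?thesis
      using finC that(1) by simp
  qed
  have inj_e: "inj_on e C"
  proof (rule inj_onI)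
    fix c d assume cd: "c \<in> C" "d \<in> C" "e c = e d"
    have "lookup (e c) c = 1"
      using cd(1) C by (auto simp: lookup_e)
    hence "lookup (e d) c = 1"
      by (simp only: cd(3))
    hence "\<rho> c = \<rho> d"
      unfolding lookup_e by (simp split: if_splits)
    thus "c = d"
      using inj cd by (auto dest: inj_onD)
  qed
  show ?thesis
  proof (rule free_vs.dim_unique[of "e ` C"])
    show "e ` C \<subseteq> ?W"
      by (auto simp: lookup_e in_keys_iff split: if_splits)
    show "?W \<subseteq> free_vs.span (e ` C)"
    proof
      fix p assume p: "p \<in> ?W"
      have "p = (\<Sum>c\<in>C. scale (lookup p c) (e c))"
      proof (rule poly_mapping_eqI)
        fix a
        show "lookup p a = lookup (\<Sum>c\<in>C. scale (lookup p c) (e c)) a"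
        proof (cases "a \<in> T")
          case True
          then obtain d where d: "d \<in> C" "\<rho> d = \<rho> a"
            using cover by blast
          hence "lookup p d = lookup p a"
            using p True C by blast
          thus ?thesis
            using lookup_comb[OF d(1), of a "lookup p"] d(2) True by simp
        next
          case False
          hence "lookup p a = 0"
            using p by (auto simp: in_keys_iff)
          moreover have "lookup (\<Sum>c\<in>C. scale (lookup p c) (e c)) a = 0"
            using False by (simp add: lookup_sum lookup_e)
          ultimately show ?thesis by simp
        qed
      qed
      also have "\<dots> \<in> free_vs.span (e ` C)"
        by (intro free_vs.span_sum free_vs.span_scale free_vs.span_base imageI)
      finally show "p \<in> free_vs.span (e ` C)" .
    qed
    show "free_vs.independent (e ` C)"
    proof
      assume "free_vs.dependent (e ` C)"
      then obtain u where u: "\<exists>v\<in>e ` C. u v \<noteq> 0" "(\<Sum>v\<in>e ` C. scale (u v) v) = 0"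
        using free_vs.dependent_finite[of "e ` C"] finC by auto
      have "(\<Sum>c\<in>C. scale (u (e c)) (e c)) = 0"
        using u(2) by (simp add: sum.reindex[OF inj_e])
      moreover have "lookup (\<Sum>c\<in>C. scale (u (e c)) (e c)) c = u (e c)" if "c \<in> C" for c
        using lookup_comb[OF that, of c "\<lambda>c. u (e c)"] that C by auto
      ultimately show False
        using u(1) by auto
    qed
    show "card (e ` C) = card C"
      by (rule card_image[OF inj_e])
  qed
qed

lemma single_power:
  "(Poly_Mapping.single (Poly_Mapping.single q 1) c :: cpoly) ^ k =
    Poly_Mapping.single (Poly_Mapping.single q k) (c ^ k)"
  by (induction k) (simp_all add: mult_single flip: single_add)

lemma prod_single:
  "(\<Prod>j\<in>A. Poly_Mapping.single (f j) (c j) :: cpoly) = Poly_Mapping.single (\<Sum>j\<in>A. f j) (\<Prod>j\<in>A. c j)"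
  by (induction A rule: infinite_finite_induct) (simp_all add: mult_single)

definition multideg :: "(nat \<Rightarrow>\<^sub>0 nat) list \<Rightarrow> (nat \<Rightarrow>\<^sub>0 nat)" where
  "multideg as = Poly_Mapping.nth (map mono_deg as)"

lemma lookup_multideg: "lookup (multideg as) i = (if i < length as then mono_deg (as ! i) else 0)"
  by (simp add: multideg_def nth.rep_eq nth_default_def)

context cyclic_wreath
begin

text \<open>
  The root of unity by which \<open>\<phi>(g)\<close> carries the monomial \<open>act g a\<close> to \<open>a\<close>.
\<close>

definition char_val :: "(nat \<Rightarrow> complex) \<Rightarrow> (nat \<Rightarrow>\<^sub>0 nat) \<Rightarrow> complex" where
  "char_val g a = (\<Prod>j=1..n. phase (g j) ^ lookup a (nmod (g j)))"

lemma phi_act: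
  assumes g: "g \<in> carrier G" and a: "a \<in> monomials"
  shows "phi g (Poly_Mapping.single (act g a) 1) = Poly_Mapping.single a (char_val g a)"
proof -
  let ?b = "act g a"
  have "phi g (Poly_Mapping.single ?b 1) =
      (\<Prod>j\<in>keys ?b. scale (phase (g j)) (pvar (nmod (g j))) ^ lookup ?b j)"
    by (simp add: phi_def subst_hom_single)
  also have "\<dots> = (\<Prod>j=1..n. scale (phase (g j)) (pvar (nmod (g j))) ^ lookup ?b j)"
    by (rule prod.mono_neutral_left) (auto simp: in_keys_iff lookup_act split: if_splits)
  also have "\<dots> = (\<Prod>j=1..n. Poly_Mapping.single (Poly_Mapping.single (nmod (g j)) (lookup a (nmod (g j))))
      (phase (g j) ^ lookup a (nmod (g j))))"
  proof (rule prod.cong)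
    fix j assume j: "j \<in> {1..n}"
    have "scale (phase (g j)) (pvar (nmod (g j))) =
        Poly_Mapping.single (Poly_Mapping.single (nmod (g j)) 1) (phase (g j))"
      by (rule poly_mapping_eqI) (simp add: pvar_def lookup_single when_def)
    thus "scale (phase (g j)) (pvar (nmod (g j))) ^ lookup ?b j =
        Poly_Mapping.single (Poly_Mapping.single (nmod (g j)) (lookup a (nmod (g j))))
          (phase (g j) ^ lookup a (nmod (g j)))"
      using j by (simp only: single_power lookup_act if_True)
  qed simp
  also have "\<dots> = Poly_Mapping.single (\<Sum>j=1..n. Poly_Mapping.single (nmod (g j)) (lookup a (nmod (g j))))
      (char_val g a)"
    by (simp add: prod_single char_val_def)
  also have "(\<Sum>j=1..n. Poly_Mapping.single (nmod (g j)) (lookup a (nmod (g j)))) =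
      (\<Sum>j=1..n. Poly_Mapping.single j (lookup a j))"
    by (rule sum.reindex_bij_betw[OF bij_nmod[OF g]])
  also have "\<dots> = a"
  proof (rule poly_mapping_eqI)
    fix i
    have "lookup a i = 0" if "i \<notin> {1..n}"
      using a that by (auto simp: monomials_def in_keys_iff)
    thus "lookup (\<Sum>j=1..n. Poly_Mapping.single j (lookup a j)) i = lookup a i"
      by (auto simp: lookup_sum lookup_single when_def)
  qed
  finally show ?thesis .
qed

definition tuples :: "nat \<Rightarrow> (nat \<Rightarrow>\<^sub>0 nat) list set" where
  "tuples t = {as. length as = t \<and> set as \<subseteq> monomials}"

lemma tensor_power_tuples: "tensor_power n t = {u. keys u \<subseteq> tuples t}"
  by (auto simp: tensor_power_def tuples_def monomials_def)

definition group_tuples :: "nat \<Rightarrow> (nat \<Rightarrow> complex) list set" where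
  "group_tuples t = {gs. length gs = t \<and> set gs \<subseteq> carrier G}"

definition acts :: "(nat \<Rightarrow> complex) list \<Rightarrow> (nat \<Rightarrow>\<^sub>0 nat) list \<Rightarrow> (nat \<Rightarrow>\<^sub>0 nat) list" where
  "acts gs as = map2 act gs as"

definition char_vals :: "(nat \<Rightarrow> complex) list \<Rightarrow> (nat \<Rightarrow>\<^sub>0 nat) list \<Rightarrow> complex" where
  "char_vals gs as = prod_list (map2 char_val gs as)"

lemma acts_tuples: "gs \<in> group_tuples t \<Longrightarrow> as \<in> tuples t \<Longrightarrow> acts gs as \<in> tuples t"
  using act_monomials by (fastforce simp: acts_def tuples_def group_tuples_def)

lemma tuples_induct [consumes 2, case_names Nil Cons]:
  assumes "gs \<in> group_tuples t" "as \<in> tuples t"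
    and "P [] []"
    and "\<And>g gs a as t. g \<in> carrier G \<Longrightarrow> a \<in> monomials \<Longrightarrow> gs \<in> group_tuples t \<Longrightarrow>
      as \<in> tuples t \<Longrightarrow> P gs as \<Longrightarrow> P (g # gs) (a # as)"
  shows "P gs as"
proof -
  have "length gs = length as" "set gs \<subseteq> carrier G" "set as \<subseteq> monomials"
    using assms(1,2) by (auto simp: group_tuples_def tuples_def)
  thus ?thesis
    by (induction gs as rule: list_induct2) (auto intro: assms(3,4) simp: group_tuples_def tuples_def)
qed

lemma map_mono_deg_acts:
  "gs \<in> group_tuples t \<Longrightarrow> as \<in> tuples t \<Longrightarrow> map mono_deg (acts gs as) = map mono_deg as"
  by (induction rule: tuples_induct) (auto simp: acts_def mono_deg_act)

lemma acts_inj: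
  assumes gs: "gs \<in> group_tuples t" and as: "as \<in> tuples t" and bs: "bs \<in> tuples t"
    and eq: "acts gs as = acts gs bs"
  shows "as = bs"
proof -
  have "length bs = length as" "set bs \<subseteq> monomials"
    using as bs by (auto simp: tuples_def)
  with gs as eq show ?thesis
  proof (induction arbitrary: bs rule: tuples_induct)
    case (Cons g gs a as t)
    then obtain b bs' where bs: "bs = b # bs'"
      by (cases bs) auto
    with Cons show ?case
      using act_inj[of g a b] by (auto simp: acts_def)
  qed simp
qed

lemma acts_surj:
  assumes "gs \<in> group_tuples t" "bs \<in> tuples t"
  obtains as where "as \<in> tuples t" "acts gs as = bs"
proof
  show "acts (map (m_inv G) gs) bs \<in> tuples t"
    by (rule acts_tuples) (use assms in \<open>auto simp: group_tuples_def\<close>)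
  show "acts gs (acts (map (m_inv G) gs) bs) = bs"
    using assms by (induction rule: tuples_induct) (auto simp: acts_def act_inv)
qed

text \<open>
  By \<open>phi_act\<close> the tensor is a multiple of the single basis element \<open>bs\<close>.
\<close>

lemma lookup_tensor_phi_acts:
  assumes "gs \<in> group_tuples t" "bs \<in> tuples t"
  shows "lookup (tensor (map2 (\<lambda>g a. phi g (Poly_Mapping.single a 1)) gs (acts gs bs))) as =
    (if as = bs then char_vals gs bs else 0)"
proof -
  have "prod_list (map2 lookup (map2 (\<lambda>g a. phi g (Poly_Mapping.single a 1)) gs (acts gs bs)) as) =
    (if as = bs then char_vals gs bs else 0)" if "length as = length bs"
    using assms(1,2) that
  proof (induction arbitrary: as rule: tuples_induct)
    case (Cons g gs b bs t)
    then obtain a as' where "as = a # as'"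
      by (cases as) auto
    thus ?case
      using Cons by (auto simp: acts_def char_vals_def phi_act lookup_single when_def)
  qed (simp add: char_vals_def)
  thus ?thesis
    using assms by (auto simp: lookup_tensor tuples_def group_tuples_def acts_def)
qed

lemma lookup_phiT:
  assumes gs: "gs \<in> group_tuples t" and u: "keys u \<subseteq> tuples t" and as: "as \<in> tuples t"
  shows "lookup (phiT gs u) as = char_vals gs as * lookup u (acts gs as)"
proof -
  have "lookup (phiT gs u) as = (\<Sum>bs\<in>keys u. lookup u bs *
      lookup (tensor (map2 (\<lambda>g a. phi g (Poly_Mapping.single a 1)) gs bs)) as)"
    by (simp add: phiT_def lookup_sum)
  also have "\<dots> = (\<Sum>bs\<in>keys u. if bs = acts gs as then char_vals gs as * lookup u (acts gs as) else 0)"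
  proof (rule sum.cong)
    fix bs assume "bs \<in> keys u"
    then obtain cs where cs: "cs \<in> tuples t" "acts gs cs = bs"
      using acts_surj[OF gs, of bs] u by blast
    have iff: "bs = acts gs as \<longleftrightarrow> as = cs"
      using acts_inj[OF gs as cs(1)] cs(2) by metis
    have "lookup (tensor (map2 (\<lambda>g a. phi g (Poly_Mapping.single a 1)) gs bs)) as =
        (if as = cs then char_vals gs cs else 0)"
      using lookup_tensor_phi_acts[OF gs cs(1), of as] by (simp only: cs(2))
    thus "lookup u bs * lookup (tensor (map2 (\<lambda>g a. phi g (Poly_Mapping.single a 1)) gs bs)) as =
        (if bs = acts gs as then char_vals gs as * lookup u (acts gs as) else 0)"
      unfolding iff using iff by (cases "as = cs") (simp_all add: mult.commute)
  qed simp
  also have "\<dots> = char_vals gs as * lookup u (acts gs as)"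
    by (simp add: in_keys_iff)
  finally show ?thesis .
qed

lemma keys_phiT:
  assumes gs: "gs \<in> group_tuples t" and u: "keys u \<subseteq> tuples t"
  shows "keys (phiT gs u) \<subseteq> tuples t"
proof
  fix as
  let ?f = "\<lambda>bs. lookup u bs *
    lookup (tensor (map2 (\<lambda>g a. phi g (Poly_Mapping.single a 1)) gs bs)) as"
  assume "as \<in> keys (phiT gs u)"
  hence "(\<Sum>bs\<in>keys u. ?f bs) \<noteq> 0"
    by (simp add: in_keys_iff phiT_def lookup_sum)
  then obtain bs where bs: "bs \<in> keys u" and "?f bs \<noteq> 0"
    by (rule sum.not_neutral_contains_not_neutral)
  hence nz: "lookup (tensor (map2 (\<lambda>g a. phi g (Poly_Mapping.single a 1)) gs bs)) as \<noteq> 0"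
    by (metis mult_zero_right)
  obtain cs where cs: "cs \<in> tuples t" "acts gs cs = bs"
    using acts_surj[OF gs, of bs] u bs by blast
  have "as = cs"
    using nz lookup_tensor_phi_acts[OF gs cs(1), of as] unfolding cs(2) by (simp split: if_splits)
  thus "as \<in> tuples t"
    using cs by simp
qed

lemma phiT_fixes_iff:
  assumes gs: "gs \<in> group_tuples t" and u: "keys u \<subseteq> tuples t"
  shows "phiT gs u = u \<longleftrightarrow>
    (\<forall>as\<in>tuples t. lookup u as = char_vals gs as * lookup u (acts gs as))"
proof
  assume "phiT gs u = u"
  thus "\<forall>as\<in>tuples t. lookup u as = char_vals gs as * lookup u (acts gs as)"
    using lookup_phiT[OF gs u] by simp
next
  assume *: "\<forall>as\<in>tuples t. lookup u as = char_vals gs as * lookup u (acts gs as)"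
  show "phiT gs u = u"
  proof (rule poly_mapping_eqI)
    fix as
    show "lookup (phiT gs u) as = lookup u as"
    proof (cases "as \<in> tuples t")
      case True
      thus ?thesis
        using lookup_phiT[OF gs u] * by simp
    next
      case False
      hence "as \<notin> keys (phiT gs u)" "as \<notin> keys u"
        using keys_phiT[OF gs u] u by auto
      thus ?thesis
        by (simp add: in_keys_iff)
    qed
  qed
qed

lemma finite_tuples_multideg: "finite {as \<in> tuples t. multideg as = k}"
proof -
  let ?D = "mono_deg k"
  define F where "F = {f :: nat \<Rightarrow> nat. \<forall>i. (i \<in> {1..n} \<longrightarrow> f i \<in> {..?D}) \<and> (i \<notin> {1..n} \<longrightarrow> f i = 0)}"
  have "finite F"
    unfolding F_def by (rule finite_set_of_finite_funs) auto
  hence "finite (lookup -` F)"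
    by (rule finite_vimageI) (simp add: inj_def)
  hence fin: "finite {as. set as \<subseteq> lookup -` F \<and> length as = t}"
    by (rule finite_lists_length_eq)
  have "lookup a \<in> F" if as: "as \<in> tuples t" "multideg as = k" and a: "a \<in> set as" for as a
  proof -
    from a obtain i where i: "i < length as" "as ! i = a"
      by (auto simp: in_set_conv_nth)
    have "mono_deg a = lookup (multideg as) i"
      using i by (simp add: lookup_multideg)
    also have "\<dots> \<le> (\<Sum>j\<in>keys (multideg as) \<union> {i}. lookup (multideg as) j)"
      by (rule member_le_sum) auto
    also have "\<dots> = mono_deg (multideg as)"
      by (rule mono_deg_superset [symmetric]) auto
    finally have deg: "mono_deg a \<le> mono_deg (multideg as)" .
    have a': "a \<in> monomials"
      using as a by (auto simp: tuples_def)
    have "lookup a j \<le> mono_deg (multideg as)" if "j \<in> {1..n}" for j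
    proof -
      have "lookup a j \<le> (\<Sum>j=1..n. lookup a j)"
        using that by (intro member_le_sum) auto
      thus ?thesis
        using deg mono_deg_monomials[OF a'] by simp
    qed
    moreover have "lookup a j = 0" if "j \<notin> {1..n}" for j
      using a' that by (auto simp: monomials_def in_keys_iff)
    ultimately show "lookup a \<in> F"
      using as(2) by (simp add: F_def)
  qed
  hence "{as \<in> tuples t. multideg as = k} \<subseteq> {as. set as \<subseteq> lookup -` F \<and> length as = t}"
    by (auto simp: tuples_def)
  thus ?thesis
    using fin by (rule finite_subset)
qed

text \<open>
  For the group \<open>\<Gamma>\<close> that acts on the tensor power, \<open>T\<close> is the set of monomial tuples on whose orbits
  the roots of unity are trivial. An invariant vanishes off \<open>T\<close>, since some element of \<open>\<Gamma>\<close> multiplies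
  the coefficient there by a number other than 1, and it is constant on the orbits in \<open>T\<close>. The orbits
  are recognized by the invariant \<open>\<rho>\<close>, and \<open>C\<close> is a set of normal forms: every orbit meets it, and
  \<open>\<rho>\<close> separates its elements.
\<close>

theorem dim_invariants:
  assumes \<Gamma>: "\<Gamma> \<subseteq> group_tuples t" and T: "T \<subseteq> tuples t" and C: "C \<subseteq> T" and inj: "inj_on \<rho> C"
    and stable: "\<And>gs as. gs \<in> \<Gamma> \<Longrightarrow> as \<in> tuples t \<Longrightarrow> acts gs as \<in> T \<longleftrightarrow> as \<in> T"
    and trivial: "\<And>gs as. gs \<in> \<Gamma> \<Longrightarrow> as \<in> T \<Longrightarrow> char_vals gs as = 1"
    and inv: "\<And>gs as. gs \<in> \<Gamma> \<Longrightarrow> as \<in> T \<Longrightarrow> \<rho> (acts gs as) = \<rho> as"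
    and nontrivial: "\<And>as. as \<in> tuples t \<Longrightarrow> as \<notin> T \<Longrightarrow>
      \<exists>gs\<in>\<Gamma>. acts gs as = as \<and> char_vals gs as \<noteq> 1"
    and normal: "\<And>as. as \<in> T \<Longrightarrow> \<exists>gs\<in>\<Gamma>. acts gs as \<in> C"
  shows "free_dim (homogeneous_piece {p \<in> tensor_power n t. \<forall>gs\<in>\<Gamma>. phiT gs p = p} k) =
    card {as \<in> C. multideg as = k}"
proof -
  let ?T = "{as \<in> T. multideg as = k}" and ?C = "{as \<in> C. multideg as = k}"
  let ?V = "homogeneous_piece {p \<in> tensor_power n t. \<forall>gs\<in>\<Gamma>. phiT gs p = p} k"
  let ?W = "{p :: ctensor. keys p \<subseteq> ?T \<and>
    (\<forall>as\<in>?T. \<forall>bs\<in>?T. \<rho> as = \<rho> bs \<longrightarrow> lookup p as = lookup p bs)}"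
  have deg: "multideg (acts gs as) = multideg as" if "gs \<in> \<Gamma>" "as \<in> tuples t" for gs as
    using map_mono_deg_acts[of gs t as] that \<Gamma> by (auto simp: multideg_def)
  have V: "p \<in> ?V \<longleftrightarrow> keys p \<subseteq> {as \<in> tuples t. multideg as = k} \<and>
      (\<forall>gs\<in>\<Gamma>. \<forall>as\<in>tuples t. lookup p as = char_vals gs as * lookup p (acts gs as))" for p
    unfolding homogeneous_piece_def tensor_power_tuples multideg_def[symmetric]
    using phiT_fixes_iff[of _ t p] \<Gamma> by blast
  have "p \<in> ?W" if p: "p \<in> ?V" for p
  proof -
    have fixed: "lookup p as = char_vals gs as * lookup p (acts gs as)"
      if "gs \<in> \<Gamma>" "as \<in> tuples t" for gs as
      using p that V by blast
    have "keys p \<subseteq> ?T"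
    proof
      fix as assume as: "as \<in> keys p"
      hence as': "as \<in> tuples t" "multideg as = k"
        using p V by auto
      have "as \<in> T"
      proof (rule ccontr)
        assume "as \<notin> T"
        then obtain gs where gs: "gs \<in> \<Gamma>" "acts gs as = as" "char_vals gs as \<noteq> 1"
          using nontrivial as'(1) by blast
        have "lookup p as = char_vals gs as * lookup p as"
          using fixed[OF gs(1) as'(1)] unfolding gs(2) .
        hence "lookup p as = 0"
          using gs(3) by (metis mult_cancel_right2)
        thus False
          using as by (simp add: in_keys_iff)
      qed
      thus "as \<in> ?T" using as' by simp
    qed
    moreover have "lookup p as = lookup p bs" if ab: "as \<in> T" "bs \<in> T" "\<rho> as = \<rho> bs" for as bs
    proof -
      obtain gs hs where gs: "gs \<in> \<Gamma>" "acts gs as \<in> C" and hs: "hs \<in> \<Gamma>" "acts hs bs \<in> C"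
        using normal ab by meson
      have "acts gs as = acts hs bs"
        using inj_onD[OF inj] gs hs inv ab by metis
      moreover have "lookup p as = lookup p (acts gs as)"
        using fixed[OF gs(1), of as] trivial[OF gs(1), of as] ab T by auto
      moreover have "lookup p bs = lookup p (acts hs bs)"
        using fixed[OF hs(1), of bs] trivial[OF hs(1), of bs] ab T by auto
      ultimately show ?thesis by simp
    qed
    ultimately show ?thesis by blast
  qed
  moreover have "p \<in> ?V" if p: "p \<in> ?W" for p
  proof -
    have "lookup p as = char_vals gs as * lookup p (acts gs as)"
      if gs: "gs \<in> \<Gamma>" and as: "as \<in> tuples t" for gs as
    proof (cases "as \<in> ?T")
      case True
      hence "acts gs as \<in> ?T" "\<rho> (acts gs as) = \<rho> as"
        using stable[OF gs as] inv[OF gs] deg[OF gs as] by auto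
      hence "lookup p (acts gs as) = lookup p as"
        using p True by blast
      thus ?thesis
        using trivial[OF gs] True by simp
    next
      case False
      hence "acts gs as \<notin> ?T"
        using stable[OF gs as] deg[OF gs as] by auto
      hence "lookup p as = 0" "lookup p (acts gs as) = 0"
        using p False by (auto simp: in_keys_iff)
      thus ?thesis by simp
    qed
    moreover have "keys p \<subseteq> {as \<in> tuples t. multideg as = k}"
      using p T by blast
    ultimately show ?thesis
      unfolding V by blast
  qed
  ultimately have "?V = ?W"
    by blast
  moreover have "free_dim ?W = card ?C"
  proof (rule dim_constant_on_fibres[of ?T ?C \<rho>])
    show "finite ?T"
      by (rule finite_subset[OF _ finite_tuples_multideg[of t k]]) (use T in auto)
    show "inj_on \<rho> ?C"
      using inj by (rule inj_on_subset) auto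
    fix as assume as: "as \<in> ?T"
    then obtain gs where "gs \<in> \<Gamma>" "acts gs as \<in> C"
      using normal by blast
    thus "\<exists>c\<in>?C. \<rho> c = \<rho> as"
      using as inv deg T by (intro bexI[of _ "acts gs as"]) auto
  qed (use C in auto)
  ultimately show ?thesis by simp
qed

end

section \<open>Sorted representatives of the orbits on monomials\<close>

text \<open>
  A decreasing sequence is determined by the multiset of its entries. This makes sorted
  representatives unique.
\<close>

lemma antimono_eqI_image_mset:
  fixes v w :: "nat \<Rightarrow> 'b :: linorder"
  assumes v: "\<And>i j. i \<in> {1..n} \<Longrightarrow> j \<in> {1..n} \<Longrightarrow> i < j \<Longrightarrow> v j \<le> v i"
    and w: "\<And>i j. i \<in> {1..n} \<Longrightarrow> j \<in> {1..n} \<Longrightarrow> i < j \<Longrightarrow> w j \<le> w i"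
    and eq: "image_mset v (mset_set {1..n}) = image_mset w (mset_set {1..n})"
    and j: "j \<in> {1..n}"
  shows "v j = w j"
proof -
  have mset: "mset (rev (map u [1..<Suc n])) = image_mset u (mset_set {1..n})" for u :: "nat \<Rightarrow> 'b"
    by (simp only: mset_rev mset_map mset_upt atLeastLessThanSuc_atLeastAtMost)
  have sorted: "sorted (rev (map u [1..<Suc n]))"
    if "\<And>i j. i \<in> {1..n} \<Longrightarrow> j \<in> {1..n} \<Longrightarrow> i < j \<Longrightarrow> u j \<le> u i" for u :: "nat \<Rightarrow> 'b"
    unfolding sorted_wrt_rev sorted_wrt_map
    by (rule sorted_wrt_mono_rel[OF _ sorted_wrt_upt]) (use that in auto)
  have "sort (rev (map w [1..<Suc n])) = rev (map v [1..<Suc n])"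
    by (rule properties_for_sort) (simp_all only: mset eq sorted[OF v])
  moreover have "sort (rev (map w [1..<Suc n])) = rev (map w [1..<Suc n])"
    by (rule properties_for_sort) (simp_all only: sorted[OF w])
  ultimately have "rev (map v [1..<Suc n]) = rev (map w [1..<Suc n])"
    by (rule trans [OF sym])
  hence "map v [1..<Suc n] = map w [1..<Suc n]"
    by (simp only: rev_is_rev_conv)
  thus ?thesis
    using j by (auto simp del: upt_Suc)
qed

lemma prod_list_prod_swap:
  "(\<Prod>a\<leftarrow>as. \<Prod>j\<in>J. f a j) = (\<Prod>j\<in>J. \<Prod>a\<leftarrow>as. f a j :: 'a :: comm_monoid_mult)"
  by (induction as) (simp_all add: prod.distrib)

lemma prod_list_power:
  "(\<Prod>a\<leftarrow>as. f a ^ k) = (\<Prod>a\<leftarrow>as. f a :: 'a :: comm_monoid_mult) ^ k"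
  by (induction as) (simp_all add: power_mult_distrib)

context cyclic_wreath
begin

lemma ex_sorting:
  fixes v :: "nat \<Rightarrow> 'b :: linorder"
  obtains g where "g \<in> carrier G"
    "\<And>i j. i \<in> {1..n} \<Longrightarrow> j \<in> {1..n} \<Longrightarrow> i < j \<Longrightarrow> v (nmod (g j)) \<le> v (nmod (g i))"
proof -
  define R where "R i j \<longleftrightarrow> v i > v j \<or> (v i = v j \<and> i < j)" for i j
  obtain s where s: "bij_betw s {1..n} {1..card {1..n}}"
    "\<And>i j. i \<in> {1..n} \<Longrightarrow> j \<in> {1..n} \<Longrightarrow> s i < s j \<longleftrightarrow> R i j"
    by (rule ex_rank[of "{1..n}" R]) (auto simp: R_def)
  have "bij_betw s {1..n} {1..n}"
    using s(1) by simp
  then obtain h where h: "h \<in> carrier G" "\<And>j. j \<in> {1..n} \<Longrightarrow> nmod (h j) = s j"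
    by (rule ex_wreath[where c = "\<lambda>_. 0"]) blast
  let ?g = "inv\<^bsub>G\<^esub> h"
  have g: "?g \<in> carrier G"
    using h(1) by simp
  have s_g: "s (nmod (?g j)) = j" if "j \<in> {1..n}" for j
  proof -
    have "s (nmod (?g j)) = nmod ((h \<otimes>\<^bsub>G\<^esub> ?g) j)"
      using h(2)[OF nmod_in[OF g that]] nmod_mult[OF h(1) g that] by simp
    thus ?thesis
      using h(1) that by simp
  qed
  have "v (nmod (?g j)) \<le> v (nmod (?g i))" if "i \<in> {1..n}" "j \<in> {1..n}" "i < j" for i j
    using s(2)[OF nmod_in[OF g that(1)] nmod_in[OF g that(2)]] s_g[OF that(1)] s_g[OF that(2)] that(3)
    by (auto simp: R_def)
  thus ?thesis
    using that g by blast
qed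

text \<open>
  The element that multiplies \<open>x\<^sub>i\<close> by \<open>\<omega>\<close> and fixes the other variables. It detects the tuples that
  cannot occur in an invariant.
\<close>

lemma ex_phase_shift:
  assumes "i \<in> {1..n}"
  obtains d where "d \<in> carrier G" "\<And>a. a \<in> monomials \<Longrightarrow> act d a = a"
    "\<And>a. char_val d a = omega m ^ lookup a i"
proof -
  have "bij_betw (\<lambda>j. j) {1..n} {1..n}"
    by (simp add: bij_betw_def)
  then obtain d where d: "d \<in> carrier G" "\<And>j. j \<in> {1..n} \<Longrightarrow> nmod (d j) = j"
    "\<And>j. j \<in> {1..n} \<Longrightarrow> phase (d j) = omega m ^ (if j = i then 1 else 0)"
    by (rule ex_wreath[where c = "\<lambda>j. if j = i then 1 else 0"]) blast
  have "act d a = a" if "a \<in> monomials" for a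
    by (rule monomials_eqI) (use that d(2) in \<open>auto simp: lookup_act\<close>)
  moreover have "char_val d a = omega m ^ lookup a i" for a
  proof -
    have "char_val d a = (\<Prod>j=1..n. if j = i then omega m ^ lookup a i else 1)"
      unfolding char_val_def by (rule prod.cong) (use d(2,3) in auto)
    thus ?thesis
      using assms by simp
  qed
  ultimately show ?thesis
    using that d(1) by blast
qed

lemma image_mset_nmod:
  assumes "g \<in> carrier G"
  shows "image_mset (\<lambda>j. f (nmod (g j))) (mset_set {1..n}) = image_mset f (mset_set {1..n})"
proof -
  have "image_mset (\<lambda>j. nmod (g j)) (mset_set {1..n}) = mset_set ((\<lambda>j. nmod (g j)) ` {1..n})"
    by (rule image_mset_mset_set) (rule bij_betw_imp_inj_on[OF bij_nmod[OF assms]])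
  also have "\<dots> = mset_set {1..n}"
    using bij_betw_imp_surj_on[OF bij_nmod[OF assms]] by simp
  finally have "image_mset f (image_mset (\<lambda>j. nmod (g j)) (mset_set {1..n})) = image_mset f (mset_set {1..n})"
    by simp
  thus ?thesis
    by (simp add: multiset.map_comp o_def)
qed

lemma char_val_one [simp]: "char_val \<one>\<^bsub>G\<^esub> a = 1"
  by (simp add: char_val_def)

lemma compatible_one:
  "a \<in> compatible \<one>\<^bsub>G\<^esub> \<longleftrightarrow> a \<in> monomials \<and> (\<forall>j\<in>{1..n}. omega m ^ lookup a j = 1) \<and>
    (\<forall>i\<in>{1..n}. \<forall>j\<in>{1..n}. i < j \<longrightarrow> lookup a j \<le> lookup a i)"
proof -
  have 1: "phase (\<one>\<^bsub>G\<^esub> j) = omega m ^ k \<longleftrightarrow> omega m ^ k = 1" if "j \<in> {1..n}" for j k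
    using that by auto
  have 2: "(lookup a j < lookup a i \<or> lookup a i = lookup a j \<and> nmod (\<one>\<^bsub>G\<^esub> i) < nmod (\<one>\<^bsub>G\<^esub> j)) \<longleftrightarrow>
      lookup a j \<le> lookup a i" if "i \<in> {1..n}" "j \<in> {1..n}" "i < j" for i j
    using that by auto
  show ?thesis
    unfolding compatible_def monomials_def mem_Collect_eq
    by (intro conj_cong ball_cong imp_cong refl 1 2) assumption+
qed

text \<open>
  Each component is sorted on its own, and its orbit is recognized by the multiset of its entries.
\<close>

lemma dim_TIA:
  "free_dim (homogeneous_piece (TIA m n t) k) =
    card {as. length as = t \<and> set as \<subseteq> compatible \<one>\<^bsub>G\<^esub> \<and> multideg as = k}"
proof -
  define \<rho> :: "(nat \<Rightarrow>\<^sub>0 nat) list \<Rightarrow> nat multiset list"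
    where "\<rho> = map (\<lambda>a. image_mset (lookup a) (mset_set {1..n}))"
  define T1 where "T1 = {a \<in> monomials. \<forall>j\<in>{1..n}. omega m ^ lookup a j = 1}"
  define T where "T = {as \<in> tuples t. set as \<subseteq> T1}"
  define C where "C = {as. length as = t \<and> set as \<subseteq> compatible \<one>\<^bsub>G\<^esub>}"
  have T1_act: "act g a \<in> T1 \<longleftrightarrow> a \<in> T1" if "g \<in> carrier G" "a \<in> monomials" for g a
  proof
    assume "a \<in> T1"
    thus "act g a \<in> T1"
      using nmod_in[OF that(1)] by (simp add: T1_def lookup_act)
  next
    assume act: "act g a \<in> T1"
    have "omega m ^ lookup a p = 1" if p: "p \<in> {1..n}" for p
    proof -
      obtain j where "j \<in> {1..n}" "nmod (g j) = p"
        using nmod_surj[OF \<open>g \<in> carrier G\<close> p] by blast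
      thus ?thesis
        using act by (auto simp: T1_def lookup_act)
    qed
    thus "a \<in> T1"
      using that(2) by (simp add: T1_def)
  qed
  have char_T1: "char_val g a = 1" if g: "g \<in> carrier G" and a: "a \<in> T1" for g a
    unfolding char_val_def
  proof (rule prod.neutral, rule ballI)
    fix j assume j: "j \<in> {1..n}"
    obtain e where e: "phase (g j) = omega m ^ e"
      using phase_is_power[OF g j] by blast
    have "omega m ^ lookup a (nmod (g j)) = 1"
      using a nmod_in[OF g j] by (simp add: T1_def)
    thus "phase (g j) ^ lookup a (nmod (g j)) = 1"
      unfolding e by (simp only: power_mult [symmetric] mult.commute[of e]) (simp only: power_mult power_one)
  qed
  have "free_dim (homogeneous_piece {p \<in> tensor_power n t. \<forall>gs\<in>group_tuples t. phiT gs p = p} k) =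
      card {as \<in> C. multideg as = k}"
  proof (rule dim_invariants[where T = T and \<rho> = \<rho>])
    show "C \<subseteq> T"
      by (auto simp: C_def T_def T1_def tuples_def compatible_one)
    show "inj_on \<rho> C"
    proof (rule inj_onI)
      fix as bs assume "as \<in> C" "bs \<in> C" "\<rho> as = \<rho> bs"
      hence "length as = length bs" "set as \<subseteq> compatible \<one>\<^bsub>G\<^esub>" "set bs \<subseteq> compatible \<one>\<^bsub>G\<^esub>" "\<rho> as = \<rho> bs"
        by (auto simp: C_def)
      thus "as = bs"
      proof (induction as bs rule: list_induct2)
        case (Cons a as b bs)
        have "a = b"
        proof (rule monomials_eqI)
          fix j assume "j \<in> {1..n}"
          thus "lookup a j = lookup b j"
            using Cons.prems
            by (intro antimono_eqI_image_mset[of n "lookup a" "lookup b"])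
               (auto simp: compatible_one \<rho>_def)
        qed (use Cons.prems in \<open>auto simp: compatible_one\<close>)
        thus ?case
          using Cons by (simp add: \<rho>_def)
      qed simp
    qed
    show "acts gs as \<in> T \<longleftrightarrow> as \<in> T" if "gs \<in> group_tuples t" "as \<in> tuples t" for gs as
    proof -
      have "set (acts gs as) \<subseteq> T1 \<longleftrightarrow> set as \<subseteq> T1"
        using that by (induction rule: tuples_induct) (auto simp: acts_def T1_act)
      thus ?thesis
        using that acts_tuples[OF that] by (simp add: T_def)
    qed
    show "char_vals gs as = 1" if "gs \<in> group_tuples t" "as \<in> T" for gs as
    proof -
      have "set as \<subseteq> T1 \<longrightarrow> char_vals gs as = 1"
        using that(1) that(2)[unfolded T_def, THEN CollectD, THEN conjunct1]
        by (induction rule: tuples_induct) (auto simp: char_vals_def char_T1)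
      thus ?thesis
        using that by (simp add: T_def)
    qed
    show "\<rho> (acts gs as) = \<rho> as" if "gs \<in> group_tuples t" "as \<in> T" for gs as
      using that(1) that(2)[unfolded T_def, THEN CollectD, THEN conjunct1]
    proof (induction rule: tuples_induct)
      case (Cons g gs a as t)
      have "image_mset (lookup (act g a)) (mset_set {1..n}) =
          image_mset (\<lambda>j. lookup a (nmod (g j))) (mset_set {1..n})"
        by (rule image_mset_cong) (auto simp: lookup_act)
      thus ?case
        using Cons image_mset_nmod[of g "lookup a"] by (simp add: acts_def \<rho>_def)
    qed (simp add: acts_def)
    show "\<exists>gs\<in>group_tuples t. acts gs as = as \<and> char_vals gs as \<noteq> 1"
      if as: "as \<in> tuples t" "as \<notin> T" for as
    proof -
      obtain b where b: "b \<in> set as" "b \<notin> T1"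
        using as by (auto simp: T_def)
      obtain xs ys where split: "as = xs @ b # ys"
        using split_list[OF b(1)] by blast
      have mono: "set xs \<subseteq> monomials" "set ys \<subseteq> monomials" "b \<in> monomials"
        using as(1) by (auto simp: tuples_def split)
      obtain j where j: "j \<in> {1..n}" "omega m ^ lookup b j \<noteq> 1"
        using b(2) mono(3) by (auto simp: T1_def)
      obtain d where d: "d \<in> carrier G" "\<And>a. a \<in> monomials \<Longrightarrow> act d a = a"
        "\<And>a. char_val d a = omega m ^ lookup a j"
        using ex_phase_shift[OF j(1)] by blast
      define gs where "gs = map (\<lambda>_. \<one>\<^bsub>G\<^esub>) xs @ d # map (\<lambda>_. \<one>\<^bsub>G\<^esub>) ys"
      have one: "map2 act (map (\<lambda>_. \<one>\<^bsub>G\<^esub>) zs) zs = zs" if "set zs \<subseteq> monomials" for zs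
        using that by (induction zs) (auto simp: act_one)
      have one': "prod_list (map2 char_val (map (\<lambda>_. \<one>\<^bsub>G\<^esub>) zs) zs) = 1" for zs
        by (induction zs) auto
      have "gs \<in> group_tuples t"
        using as(1) d(1) by (auto simp: gs_def group_tuples_def split tuples_def)
      moreover have "acts gs as = as"
        using one mono d(2) by (simp add: acts_def gs_def split)
      moreover have "char_vals gs as \<noteq> 1"
        using one' j(2) d(3) by (simp add: char_vals_def gs_def split)
      ultimately show ?thesis by blast
    qed
    show "\<exists>gs\<in>group_tuples t. acts gs as \<in> C" if as: "as \<in> T" for as
    proof -
      have ex: "\<exists>g\<in>carrier G. act g a \<in> compatible \<one>\<^bsub>G\<^esub>" if a: "a \<in> T1" for a
      proof -
        obtain g where g: "g \<in> carrier G"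
          "\<And>i j. i \<in> {1..n} \<Longrightarrow> j \<in> {1..n} \<Longrightarrow> i < j \<Longrightarrow> lookup a (nmod (g j)) \<le> lookup a (nmod (g i))"
          by (rule ex_sorting[of "lookup a"]) blast
        have "act g a \<in> T1"
          using T1_act[OF g(1)] a by (simp add: T1_def)
        hence "act g a \<in> compatible \<one>\<^bsub>G\<^esub>"
          using g(2) by (simp add: compatible_one T1_def lookup_act)
        thus ?thesis
          using g(1) by blast
      qed
      then obtain f where f: "\<forall>a\<in>T1. f a \<in> carrier G \<and> act (f a) a \<in> compatible \<one>\<^bsub>G\<^esub>"
        by metis
      have "map2 act (map f as) as = map (\<lambda>a. act (f a) a) as"
        by (induction as) auto
      hence "map f as \<in> group_tuples t" "acts (map f as) as \<in> C"
        using f as by (auto simp: group_tuples_def T_def tuples_def C_def acts_def)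
      thus ?thesis by blast
    qed
  qed (auto simp: T_def)
  moreover have "TIA m n t = {p \<in> tensor_power n t. \<forall>gs\<in>group_tuples t. phiT gs p = p}"
    by (auto simp: TIA_def group_tuples_def)
  ultimately show ?thesis
    by (simp add: C_def conj_assoc)
qed

text \<open>
  A single permutation sorts all columns at once, and the orbit is recognized by the multiset of
  columns.
\<close>

lemma dim_DIA:
  "free_dim (homogeneous_piece (DIA m n t) k) =
    card {as \<in> sorted_tuples \<one>\<^bsub>G\<^esub> t. multideg as = k}"
proof -
  define \<rho> where "\<rho> as = image_mset (col as) (mset_set {1..n})" for as
  define T where "T = {as \<in> tuples t. \<forall>j\<in>{1..n}. (\<Prod>a\<leftarrow>as. omega m ^ lookup a j) = 1}"
  define \<Gamma> where "\<Gamma> = replicate t ` carrier G"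
  have acts_diag: "acts (replicate t g) as = map (act g) as" if "as \<in> tuples t" for g as
    using that by (auto simp: acts_def tuples_def zip_replicate1)
  have char_diag: "char_vals (replicate t g) as = (\<Prod>a\<leftarrow>as. char_val g a)" if "as \<in> tuples t" for g as
    using that by (auto simp: char_vals_def tuples_def zip_replicate1 o_def)
  have lookup_map_act: "(\<Prod>a\<leftarrow>map (act g) as. omega m ^ lookup a j) = (\<Prod>a\<leftarrow>as. omega m ^ lookup a (nmod (g j)))"
    if "j \<in> {1..n}" for g as j
    using that by (simp add: o_def lookup_act)
  have col_map_act: "col (map (act g) as) j = col as (nmod (g j))" if "j \<in> {1..n}" for g as j
    using that by (simp add: col_def o_def lookup_act)
  have sorted: "as \<in> sorted_tuples \<one>\<^bsub>G\<^esub> t \<longleftrightarrow>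
      as \<in> T \<and> (\<forall>i\<in>{1..n}. \<forall>j\<in>{1..n}. i < j \<longrightarrow> col as j \<le> col as i)" for as
  proof -
    have 1: "phase (\<one>\<^bsub>G\<^esub> j) = x \<longleftrightarrow> x = 1" if "j \<in> {1..n}" for j x
      using that by auto
    have 2: "(col as j < col as i \<or> col as i = col as j \<and> nmod (\<one>\<^bsub>G\<^esub> i) < nmod (\<one>\<^bsub>G\<^esub> j)) \<longleftrightarrow>
        col as j \<le> col as i" if "i \<in> {1..n}" "j \<in> {1..n}" "i < j" for i j
      using that by auto
    show ?thesis
      unfolding sorted_tuples_def T_def tuples_def mem_Collect_eq conj_assoc
      by (intro conj_cong ball_cong imp_cong refl 1 2) assumption+
  qed
  have stable: "map (act g) as \<in> T \<longleftrightarrow> as \<in> T" if g: "g \<in> carrier G" and as: "as \<in> tuples t" for g as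
  proof -
    have "map (act g) as \<in> tuples t"
      using as by (auto simp: tuples_def)
    moreover have "(\<forall>j\<in>{1..n}. (\<Prod>a\<leftarrow>as. omega m ^ lookup a (nmod (g j))) = 1) \<longleftrightarrow>
        (\<forall>j\<in>{1..n}. (\<Prod>a\<leftarrow>as. omega m ^ lookup a j) = 1)"
      using nmod_in[OF g] nmod_surj[OF g] by metis
    ultimately show ?thesis
      using as lookup_map_act[of _ g as] by (simp add: T_def del: atLeastAtMost_iff)
  qed
  have "free_dim (homogeneous_piece {p \<in> tensor_power n t. \<forall>gs\<in>\<Gamma>. phiT gs p = p} k) =
      card {as \<in> sorted_tuples \<one>\<^bsub>G\<^esub> t. multideg as = k}"
  proof (rule dim_invariants[where T = T and \<rho> = \<rho>])
    show "\<Gamma> \<subseteq> group_tuples t"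
      by (auto simp: \<Gamma>_def group_tuples_def)
    show "sorted_tuples \<one>\<^bsub>G\<^esub> t \<subseteq> T"
      using sorted by blast
    show "inj_on \<rho> (sorted_tuples \<one>\<^bsub>G\<^esub> t)"
    proof (rule inj_onI)
      fix as bs assume as: "as \<in> sorted_tuples \<one>\<^bsub>G\<^esub> t" and bs: "bs \<in> sorted_tuples \<one>\<^bsub>G\<^esub> t"
        and eq: "\<rho> as = \<rho> bs"
      have col_eq: "col as j = col bs j" if "j \<in> {1..n}" for j
        using as bs eq that
        by (intro antimono_eqI_image_mset[of n "col as" "col bs"]) (auto simp: sorted \<rho>_def)
      have len: "length as = length bs" and mono: "set as \<subseteq> monomials" "set bs \<subseteq> monomials"
        using as bs by (auto simp: sorted_tuples_def)
      show "as = bs"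
      proof (rule nth_equalityI[OF len])
        fix i assume i: "i < length as"
        show "as ! i = bs ! i"
        proof (rule monomials_eqI)
          fix j assume "j \<in> {1..n}"
          hence "map (\<lambda>a. lookup a j) as = map (\<lambda>a. lookup a j) bs"
            using col_eq by (simp add: col_def)
          thus "lookup (as ! i) j = lookup (bs ! i) j"
            using i len by (metis nth_map)
        qed (use i len mono in \<open>auto dest: nth_mem\<close>)
      qed
    qed
    show "acts gs as \<in> T \<longleftrightarrow> as \<in> T" if "gs \<in> \<Gamma>" "as \<in> tuples t" for gs as
      using that stable by (auto simp: \<Gamma>_def acts_diag)
    show "char_vals gs as = 1" if "gs \<in> \<Gamma>" "as \<in> T" for gs as
    proof -
      obtain g where g: "g \<in> carrier G" "gs = replicate t g"
        using \<open>gs \<in> \<Gamma>\<close> by (auto simp: \<Gamma>_def)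
      have as: "as \<in> tuples t"
        using \<open>as \<in> T\<close> by (simp add: T_def)
      have "(\<Prod>a\<leftarrow>as. phase (g j) ^ lookup a (nmod (g j))) = 1" if j: "j \<in> {1..n}" for j
      proof -
        obtain e where e: "phase (g j) = omega m ^ e"
          using phase_is_power[OF g(1) j] by blast
        have "(\<Prod>a\<leftarrow>as. phase (g j) ^ lookup a (nmod (g j))) =
            (\<Prod>a\<leftarrow>as. (omega m ^ lookup a (nmod (g j))) ^ e)"
          unfolding e by (simp flip: power_mult add: mult.commute)
        also have "\<dots> = 1"
          using \<open>as \<in> T\<close> nmod_in[OF g(1) j] by (simp add: prod_list_power T_def)
        finally show ?thesis .
      qed
      thus ?thesis
        by (simp add: g(2) char_diag[OF as] char_val_def prod_list_prod_swap)
    qed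
    show "\<rho> (acts gs as) = \<rho> as" if gs: "gs \<in> \<Gamma>" "as \<in> T" for gs as
    proof -
      obtain g where g: "g \<in> carrier G" "gs = replicate t g"
        using gs by (auto simp: \<Gamma>_def)
      have "\<rho> (map (act g) as) = image_mset (\<lambda>j. col as (nmod (g j))) (mset_set {1..n})"
        unfolding \<rho>_def by (rule image_mset_cong) (simp add: col_map_act)
      thus ?thesis
        using gs g image_mset_nmod[OF g(1), of "col as"] by (simp add: acts_diag T_def \<rho>_def)
    qed
    show "\<exists>gs\<in>\<Gamma>. acts gs as = as \<and> char_vals gs as \<noteq> 1" if as: "as \<in> tuples t" "as \<notin> T" for as
    proof -
      obtain j where j: "j \<in> {1..n}" "(\<Prod>a\<leftarrow>as. omega m ^ lookup a j) \<noteq> 1"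
        using as by (auto simp: T_def)
      obtain d where d: "d \<in> carrier G" "\<And>a. a \<in> monomials \<Longrightarrow> act d a = a"
        "\<And>a. char_val d a = omega m ^ lookup a j"
        using ex_phase_shift[OF j(1)] by blast
      have "map (act d) as = as"
        using as(1) d(2) by (intro map_idI) (auto simp: tuples_def)
      hence "acts (replicate t d) as = as \<and> char_vals (replicate t d) as \<noteq> 1"
        using as(1) d(3) j(2) by (simp add: acts_diag char_diag)
      thus ?thesis
        using d(1) by (auto simp: \<Gamma>_def)
    qed
    show "\<exists>gs\<in>\<Gamma>. acts gs as \<in> sorted_tuples \<one>\<^bsub>G\<^esub> t" if as: "as \<in> T" for as
    proof -
      obtain g where g: "g \<in> carrier G"
        "\<And>i j. i \<in> {1..n} \<Longrightarrow> j \<in> {1..n} \<Longrightarrow> i < j \<Longrightarrow> col as (nmod (g j)) \<le> col as (nmod (g i))"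
        by (rule ex_sorting[of "col as"]) blast
      have as': "as \<in> tuples t"
        using as by (simp add: T_def)
      have "map (act g) as \<in> T"
        using stable[OF g(1) as'] as by simp
      hence "acts (replicate t g) as \<in> sorted_tuples \<one>\<^bsub>G\<^esub> t"
        using g(2) by (simp add: sorted acts_diag[OF as'] col_map_act)
      thus ?thesis
        using g(1) by (auto simp: \<Gamma>_def)
    qed
  qed (auto simp: T_def)
  moreover have "DIA m n t = {p \<in> tensor_power n t. \<forall>gs\<in>\<Gamma>. phiT gs p = p}"
    by (auto simp: DIA_def \<Gamma>_def)
  ultimately show ?thesis
    by simp
qed

end

section \<open>Products of generating functions\<close>

definition mfps_monomial :: "(nat \<Rightarrow>\<^sub>0 nat) \<Rightarrow> 'a :: comm_ring_1 mfps" where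
  "mfps_monomial e = Abs_mfps (\<lambda>k. if k = e then 1 else 0)"

lemma mfps_nth_monomial_mult:
  "mfps_nth (mfps_monomial e * f) k = (\<Sum>b | e + b = k. mfps_nth f b)"
proof -
  have "mfps_nth (mfps_monomial e * f) k = (\<Sum>(a, b)\<in>splits k. if a = e then mfps_nth f b else 0)"
    unfolding times_mfps_def mfps_monomial_def mfps_nth_Abs
    by (rule sum.cong) auto
  also have "\<dots> = (\<Sum>(a, b)\<in>Pair e ` {b. e + b = k}. mfps_nth f b)"
    by (rule sum.mono_neutral_cong_right[OF finite_splits]) (auto simp: splits_def)
  also have "\<dots> = (\<Sum>b | e + b = k. mfps_nth f b)"
    by (subst sum.reindex) (auto simp: inj_on_def)
  finally show ?thesis .
qed

lemma mfps_monomial_mult: "mfps_monomial a * mfps_monomial b = mfps_monomial (a + b)"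
proof (rule mfps_ext)
  fix k
  have "finite {c. a + c = k}"
  proof (rule finite_subset)
    show "{c. a + c = k} \<subseteq> snd ` splits k"
      by (force simp: splits_def)
  qed simp
  moreover have "mfps_nth (mfps_monomial a * mfps_monomial b) k =
      (\<Sum>c | a + c = k. if c = b then 1 else (0 :: 'a))"
    unfolding mfps_nth_monomial_mult by (simp add: mfps_monomial_def)
  ultimately show "mfps_nth (mfps_monomial a * mfps_monomial b) k = mfps_nth (mfps_monomial (a + b) :: 'a mfps) k"
    by (auto simp: mfps_monomial_def)
qed

lemma mfps_monomial_0: "mfps_monomial 0 = 1"
  by (simp add: mfps_monomial_def one_mfps_def)

lemma prod_mfps_var_power:
  "(\<Prod>i<t. mfps_var i ^ f i) = mfps_monomial (\<Sum>i<t. Poly_Mapping.single i (f i))"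
proof -
  have "mfps_var i ^ k = (mfps_monomial (Poly_Mapping.single i k) :: 'a mfps)" for i k
  proof (induction k)
    case (Suc k)
    have "(mfps_var i :: 'a mfps) = mfps_monomial (Poly_Mapping.single i 1)"
      by (simp add: mfps_var_def mfps_monomial_def)
    thus ?case
      using Suc by (simp add: mfps_monomial_mult flip: single_add)
  qed (simp add: mfps_monomial_0)
  thus ?thesis
    by (induction t) (simp_all add: mfps_monomial_0 mfps_monomial_mult add.commute)
qed

lemma mfps_nth_sum: "mfps_nth (\<Sum>x\<in>A. f x) k = (\<Sum>x\<in>A. mfps_nth (f x) k)"
  by (induction A rule: infinite_finite_induct) (simp_all add: zero_mfps_def plus_mfps_def)

text \<open>
  Multiplying generating functions counts pairs, graded by the sum of the degrees.
\<close>

lemma mfps_nth_generating_mult: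
  assumes "finite A" and fin: "\<And>k. finite {s \<in> S. d s = k}"
  shows "mfps_nth ((\<Sum>x\<in>A. mfps_monomial (e x)) * Abs_mfps (\<lambda>k. of_nat (card {s \<in> S. d s = k}))) k =
    (of_nat (card {(x, s) \<in> A \<times> S. e x + d s = k}) :: 'a :: comm_ring_1)"
proof -
  let ?F = "Abs_mfps (\<lambda>k. of_nat (card {s \<in> S. d s = k})) :: 'a mfps"
  have summand: "finite {s \<in> S. e x + d s = k} \<and>
      mfps_nth (mfps_monomial (e x) * ?F) k = of_nat (card {s \<in> S. e x + d s = k})" for x
  proof (cases "\<exists>b. e x + b = k")
    case True
    then obtain b where b: "e x + b = k" by blast
    have "{c. e x + c = k} = {b}" "{s \<in> S. e x + d s = k} = {s \<in> S. d s = b}"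
      using b by auto
    thus ?thesis
      using fin by (simp add: mfps_nth_monomial_mult)
  next
    case False
    hence "{c. e x + c = k} = {}" "{s \<in> S. e x + d s = k} = {}"
      by auto
    thus ?thesis
      by (simp only: mfps_nth_monomial_mult) simp
  qed
  have "mfps_nth ((\<Sum>x\<in>A. mfps_monomial (e x)) * ?F) k = (\<Sum>x\<in>A. of_nat (card {s \<in> S. e x + d s = k}))"
    unfolding sum_distrib_right mfps_nth_sum using summand by simp
  also have "\<dots> = of_nat (card (Sigma A (\<lambda>x. {s \<in> S. e x + d s = k})))"
    using assms(1) summand by simp
  also have "Sigma A (\<lambda>x. {s \<in> S. e x + d s = k}) = {(x, s) \<in> A \<times> S. e x + d s = k}"
    by auto
  finally show ?thesis .
qed

lemma bij_betw_card_level: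
  assumes "bij_betw \<Phi> X Y" "\<And>x. x \<in> X \<Longrightarrow> d (\<Phi> x) = w x"
  shows "card {x \<in> X. w x = k} = card {y \<in> Y. d y = k}"
proof (rule bij_betw_same_card)
  show "bij_betw \<Phi> {x \<in> X. w x = k} {y \<in> Y. d y = k}"
    using assms unfolding bij_betw_def inj_on_def by auto
qed

context cyclic_wreath
begin

text \<open>
  The translation that takes the sequences compatible with 1 to those compatible with \<open>g\<close>.
\<close>

definition base :: "(nat \<Rightarrow> complex) \<Rightarrow> (nat \<Rightarrow>\<^sub>0 nat)" where
  "base g = (SOME h. mono_deg h = flag_major m n g \<and>
    compatible g = (+) h ` compatible \<one>\<^bsub>G\<^esub>)"

lemma base:
  assumes "g \<in> carrier G"
  shows "mono_deg (base g) = flag_major m n g" "compatible g = (+) (base g) ` compatible \<one>\<^bsub>G\<^esub>"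
  using someI_ex[OF compatible_flag_major[OF assms]] unfolding base_def by blast+

definition add_base :: "(nat \<Rightarrow> complex) list \<Rightarrow> (nat \<Rightarrow>\<^sub>0 nat) list \<Rightarrow> (nat \<Rightarrow>\<^sub>0 nat) list" where
  "add_base gs bs = map2 (\<lambda>g b. base g + b) gs bs"

lemma bij_betw_add_base:
  assumes "set gs \<subseteq> carrier G"
  shows "bij_betw (add_base gs) {bs. length bs = length gs \<and> set bs \<subseteq> compatible \<one>\<^bsub>G\<^esub>}
    {ls. list_all2 (\<lambda>l g. l \<in> compatible g) ls gs}"
  using assms
proof (induction gs)
  case Nil
  have "{bs :: (nat \<Rightarrow>\<^sub>0 nat) list. length bs = length [] \<and> set bs \<subseteq> compatible \<one>\<^bsub>G\<^esub>} = {[]}"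
    by auto
  thus ?case
    by (simp add: bij_betw_def add_base_def)
next
  case (Cons g gs)
  let ?B = "\<lambda>gs :: (nat \<Rightarrow> complex) list. {bs. length bs = length gs \<and> set bs \<subseteq> compatible \<one>\<^bsub>G\<^esub>}"
  let ?L = "\<lambda>gs. {ls. list_all2 (\<lambda>l g. l \<in> compatible g) ls gs}"
  have IH: "bij_betw (add_base gs) (?B gs) (?L gs)"
    using Cons by simp
  have g: "compatible g = (+) (base g) ` compatible \<one>\<^bsub>G\<^esub>"
    using base(2)[of g] Cons.prems by simp
  have Cons_eq: "add_base (g # gs) (b # bs) = (base g + b) # add_base gs bs" for b bs
    by (simp add: add_base_def)
  show ?case
    unfolding bij_betw_def
  proof
    show "inj_on (add_base (g # gs)) (?B (g # gs))"
    proof (rule inj_onI)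
      fix bs bs' assume *: "bs \<in> ?B (g # gs)" "bs' \<in> ?B (g # gs)" "add_base (g # gs) bs = add_base (g # gs) bs'"
      then obtain b cs b' cs' where "bs = b # cs" "bs' = b' # cs'"
        by (cases bs; cases bs') auto
      thus "bs = bs'"
        using * inj_onD[OF bij_betw_imp_inj_on[OF IH], of cs cs'] by (simp add: Cons_eq)
    qed
    show "add_base (g # gs) ` ?B (g # gs) = ?L (g # gs)"
    proof (intro equalityI subsetI)
      fix ls assume "ls \<in> add_base (g # gs) ` ?B (g # gs)"
      then obtain bs where "bs \<in> ?B (g # gs)" "ls = add_base (g # gs) bs"
        by blast
      then obtain b cs where "ls = (base g + b) # add_base gs cs" "b \<in> compatible \<one>\<^bsub>G\<^esub>" "cs \<in> ?B gs"
        by (cases bs) (auto simp: Cons_eq)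
      thus "ls \<in> ?L (g # gs)"
        using g bij_betwE[OF IH] by auto
    next
      fix ls assume "ls \<in> ?L (g # gs)"
      then obtain l ks where ls: "ls = l # ks" "l \<in> compatible g" "ks \<in> ?L gs"
        by (cases ls) auto
      obtain b where b: "b \<in> compatible \<one>\<^bsub>G\<^esub>" "l = base g + b"
        using ls(2) unfolding g by blast
      obtain cs where cs: "cs \<in> ?B gs" "ks = add_base gs cs"
        using ls(3) bij_betw_imp_surj_on[OF IH] by blast
      have "ls = add_base (g # gs) (b # cs)"
        by (simp add: ls(1) b(2) cs(2) Cons_eq)
      moreover have "b # cs \<in> ?B (g # gs)"
        using b(1) cs(1) by simp
      ultimately show "ls \<in> add_base (g # gs) ` ?B (g # gs)"
        by blast
    qed
  qed
qed

lemma multideg_add_base: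
  assumes "set gs \<subseteq> carrier G" "length bs = length gs"
  shows "multideg (add_base gs bs) =
    (\<Sum>i<length gs. Poly_Mapping.single i (flag_major m n (gs ! i))) + multideg bs"
proof (rule poly_mapping_eqI)
  fix i
  show "lookup (multideg (add_base gs bs)) i =
    lookup ((\<Sum>i<length gs. Poly_Mapping.single i (flag_major m n (gs ! i))) + multideg bs) i"
    using assms base(1)[of "gs ! i"]
    by (auto simp: lookup_multideg add_base_def lookup_add lookup_sum lookup_single when_def
        mono_deg_add subset_iff)
qed

text \<open>
  Translating each component by its base sequence and then gluing turns a factorization of 1 and a
  tuple of sequences compatible with 1 into a sorted tuple. Only the translation changes the
  degrees.
\<close>

theorem card_sorted_tuples:
  "card {as \<in> sorted_tuples \<one>\<^bsub>G\<^esub> t. multideg as = k} =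
    card {(gs, bs) \<in> {gs. length gs = t \<and> set gs \<subseteq> carrier G \<and> product gs = \<one>\<^bsub>G\<^esub>} \<times>
        {bs. length bs = t \<and> set bs \<subseteq> compatible \<one>\<^bsub>G\<^esub>}.
      (\<Sum>i<t. Poly_Mapping.single i (flag_major m n (gs ! i))) + multideg bs = k}"
proof -
  let ?A = "{gs. length gs = t \<and> set gs \<subseteq> carrier G \<and> product gs = \<one>\<^bsub>G\<^esub>}"
  let ?B = "{bs. length bs = t \<and> set bs \<subseteq> compatible \<one>\<^bsub>G\<^esub>}"
  let ?\<Psi> = "\<lambda>(gs, bs). (gs, add_base gs bs)" and ?\<Phi> = "\<lambda>(gs, ls). glue gs ls"
  have add_base: "bij_betw (add_base gs) ?B {ls. list_all2 (\<lambda>l g. l \<in> compatible g) ls gs}" if "gs \<in> ?A" for gs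
    using that bij_betw_add_base[of gs] by simp
  have "bij_betw ?\<Psi> (?A \<times> ?B) (factored \<one>\<^bsub>G\<^esub> t)"
    unfolding bij_betw_def
  proof
    show "inj_on ?\<Psi> (?A \<times> ?B)"
      using bij_betw_imp_inj_on[OF add_base] by (auto simp: inj_on_def)
    have "?\<Psi> ` (?A \<times> ?B) = Sigma ?A (\<lambda>gs. add_base gs ` ?B)"
      by auto
    also have "\<dots> = Sigma ?A (\<lambda>gs. {ls. list_all2 (\<lambda>l g. l \<in> compatible g) ls gs})"
      using bij_betw_imp_surj_on[OF add_base] by (intro Sigma_cong refl)
    also have "\<dots> = factored \<one>\<^bsub>G\<^esub> t"
      by (auto simp: factored_def)
    finally show "?\<Psi> ` (?A \<times> ?B) = factored \<one>\<^bsub>G\<^esub> t" .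
  qed
  hence bij: "bij_betw (?\<Phi> \<circ> ?\<Psi>) (?A \<times> ?B) (sorted_tuples \<one>\<^bsub>G\<^esub> t)"
    by (rule bij_betw_trans) (rule bij_betw_glue[OF one_closed])
  have deg: "multideg ((?\<Phi> \<circ> ?\<Psi>) x) =
      (\<Sum>i<t. Poly_Mapping.single i (flag_major m n (fst x ! i))) + multideg (snd x)" if x: "x \<in> ?A \<times> ?B" for x
  proof -
    obtain gs bs where gs: "x = (gs, bs)" "gs \<in> ?A" "bs \<in> ?B"
      using x by (cases x) auto
    have "list_all2 (\<lambda>l g. l \<in> compatible g) (add_base gs bs) gs"
      using bij_betwE[OF add_base[OF gs(2)]] gs(3) by blast
    hence "multideg (glue gs (add_base gs bs)) = multideg (add_base gs bs)"
      using gs(2) map_mono_deg_glue[of gs "add_base gs bs"] by (simp add: multideg_def)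
    thus ?thesis
      using gs multideg_add_base[of gs bs] by simp
  qed
  show ?thesis
    using bij_betw_card_level[where d = multideg, OF bij deg, of k] by (simp add: case_prod_unfold mem_Times_iff conj_assoc)
qed

lemma finite_compatible_tuples:
  "finite {bs \<in> {bs. length bs = t \<and> set bs \<subseteq> compatible \<one>\<^bsub>G\<^esub>}. multideg bs = k}"
  by (rule finite_subset[OF _ finite_tuples_multideg[of t k]])
     (auto simp: tuples_def compatible_one)

lemma F_T_eq:
  "F_T m n t = Abs_mfps (\<lambda>k. of_nat
    (card {bs \<in> {bs. length bs = t \<and> set bs \<subseteq> compatible \<one>\<^bsub>G\<^esub>}. multideg bs = k}))"
  by (simp add: F_T_def hilbert_series_def dim_TIA conj_assoc)

lemma F_T_constant_coeff: "mfps_nth (F_T m n t) 0 \<noteq> 0"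
proof -
  have "replicate t 0 \<in> {bs \<in> {bs. length bs = t \<and> set bs \<subseteq> compatible \<one>\<^bsub>G\<^esub>}. multideg bs = 0}"
    by (auto simp: compatible_one monomials_def lookup_multideg intro!: poly_mapping_eqI)
  hence "card {bs \<in> {bs. length bs = t \<and> set bs \<subseteq> compatible \<one>\<^bsub>G\<^esub>}. multideg bs = 0} \<noteq> 0"
    using finite_compatible_tuples[of t 0] by (subst card_0_eq) auto
  thus ?thesis
    by (simp only: F_T_eq mfps_nth_Abs of_nat_eq_0_iff) simp
qed

lemma F_D_eq:
  "F_D m n t =
    (\<Sum>gs \<in> {gs. length gs = t \<and> set gs \<subseteq> carrier G \<and> product gs = \<one>\<^bsub>G\<^esub>}.
      \<Prod>i<t. mfps_var i ^ flag_major m n (gs ! i)) * F_T m n t" (is "_ = (\<Sum>gs\<in>?A. _) * _")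
proof (rule mfps_ext)
  fix k
  have "?A \<subseteq> {gs. set gs \<subseteq> carrier G \<and> length gs = t}"
    by auto
  hence "finite ?A"
    using finite_lists_length_eq[OF finite_carrier] by (rule finite_subset)
  thus "mfps_nth (F_D m n t) k =
      mfps_nth ((\<Sum>gs\<in>?A. \<Prod>i<t. mfps_var i ^ flag_major m n (gs ! i)) * F_T m n t) k"
    unfolding F_T_eq prod_mfps_var_power
    by (subst mfps_nth_generating_mult[OF _ finite_compatible_tuples])
       (simp_all only: F_D_def hilbert_series_def mfps_nth_Abs dim_DIA card_sorted_tuples)
qed

end

theorem theorem3:
  fixes m n t :: nat
  assumes "m \<ge> 1" and "n \<ge> 1" and "t \<ge> 1"
  shows "F_D m n t / F_T m n t =
    (\<Sum>\<pi>s \<in> {\<pi>s. length \<pi>s = t \<and> set \<pi>s \<subseteq> carrier (wreath m n) \<and>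
                   foldr (\<lambda>\<pi> \<sigma>. \<pi> \<otimes>\<^bsub>wreath m n\<^esub> \<sigma>) \<pi>s \<one>\<^bsub>wreath m n\<^esub> = \<one>\<^bsub>wreath m n\<^esub>}.
       \<Prod>i<t. mfps_var i ^ flag_major m n (\<pi>s ! i))"
proof -
  interpret cyclic_wreath m n
    by unfold_locales (rule assms(1))
  show ?thesis
    unfolding mfps_divide_eq_iff[OF F_T_constant_coeff] by (rule F_D_eq)
qed

end
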